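(* Let $A\subseteq\mathbb R^d$ be a configuration of $n$ points affinely spanning $\mathbb R^d$ and let $k\in[d+1]$. Let $s=\max(n-k+1,d+2)$. Then \[\mathcal F^{(k)}(A)\cong\sum_{J\in\binom{[n]}{s}}\mathcal F(A_J).\]
   Context: Let $A=\{a_1,\dots,a_n\}$ be labelled by $[n]$; for $J\subseteq[n]$, $A_J=\{a_j:j\in J\}$. Let $\pi:\mathbb R^n\to\mathbb R^{d+1}$, $e_i\mapsto(a_i,1)$. For a polytope $Q\subset\mathbb R^n$ and $w\in(\mathbb R^n)^*$, $Q^w$ is the face minimizing $w$; the $\pi$-coherent subdivision induced by $w$ is $\{\pi(F):\exists\tilde w,\ \tilde w|_{\ker\pi}=w|_{\ker\pi},\ Q^{\tilde w}=F\}$. The fiber polytope of $\pi:Q\to\pi(Q)$ (Billera–Sturmfels) is a polytope whose normal fan is the fiber fan, i.e. the fan in $(\mathbb R^n)^*$ whose relatively open cones are the sets of $w$ inducing the same coherent subdivision. With $\Delta_n^{(k)}=[0,1]^n\cap\{\sum x_i=k\}$, the $k$-th hypersecondary polytope $\mathcal F^{(k)}(A)$ is the fiber polytope of $\pi:\Delta_n^{(k)}\to\pi(\Delta_n^{(k)})$, and $\mathcal F(A)=\mathcal F^{(1)}(A)$ is the secondary polytope. For $J\subseteq[n]$, $\mathcal F(A_J)\subset\mathbb R^J$ is regarded in $\mathbb R^n$ via the coordinate inclusion. For polytopes $P,Q$ in the same space, $P\cong Q$ (normally equivalent) means they have the same normal fan (equivalently each normal fan refines the other). *)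

theory Defs
  imports "HOL-Analysis.Analysis" "HOL-Library.Set_Algebras"
begin

(* Linear functionals on a subspace V of a Euclidean space are represented by the
   vectors w of V via the inner product.  The parameter V is the ambient space in
   which polytopes and fans live: UNIV for R^n, or a coordinate subspace R^J. *)

definition min_face :: "'a::euclidean_space set \<Rightarrow> 'a \<Rightarrow> 'a set" where
  "min_face Q w = {x \<in> Q. \<forall>y\<in>Q. w \<bullet> x \<le> w \<bullet> y}"

definition normal_cone :: "'a::euclidean_space set \<Rightarrow> 'a set \<Rightarrow> 'a set \<Rightarrow> 'a set" where
  "normal_cone V P F = {w \<in> V. F \<subseteq> min_face P w}"

definition normal_fan :: "'a::euclidean_space set \<Rightarrow> 'a set \<Rightarrow> 'a set set" where
  "normal_fan V P = {normal_cone V P F | F. F face_of P \<and> F \<noteq> {}}"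

definition normally_equivalent :: "'a::euclidean_space set \<Rightarrow> 'a set \<Rightarrow> bool" where
  "normally_equivalent P Q \<longleftrightarrow> normal_fan UNIV P = normal_fan UNIV Q"

(* Cells of a coherent subdivision are marked: a cell pi(F) is recorded together with
   the face F it comes from.  The bare images pi(F) would not do: for three collinear
   points, lifting the middle one onto or above the segment joining the outer two gives
   the same images, although these lifts lie in different cones of the fiber fan. *)

definition coherent_subdivision ::
  "'a::euclidean_space set \<Rightarrow> ('a \<Rightarrow> 'b::real_vector) \<Rightarrow> 'a set \<Rightarrow> 'a \<Rightarrow> ('b set \<times> 'a set) set" where
  "coherent_subdivision V \<pi> Q w =
     {(\<pi> ` F, F) | F. \<exists>w'\<in>V. (\<forall>x\<in>V. \<pi> x = 0 \<longrightarrow> w' \<bullet> x = w \<bullet> x) \<and> min_face Q w' = F}"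

definition fiber_fan_open_cones ::
  "'a::euclidean_space set \<Rightarrow> ('a \<Rightarrow> 'b::real_vector) \<Rightarrow> 'a set \<Rightarrow> 'a set set" where
  "fiber_fan_open_cones V \<pi> Q =
     {{w' \<in> V. coherent_subdivision V \<pi> Q w' = coherent_subdivision V \<pi> Q w} | w. w \<in> V}"

(* Fiber polytopes are only determined up to normal equivalence, hence a predicate. *)

definition is_fiber_polytope ::
  "'a::euclidean_space set \<Rightarrow> ('a \<Rightarrow> 'b::real_vector) \<Rightarrow> 'a set \<Rightarrow> 'a set \<Rightarrow> bool" where
  "is_fiber_polytope V \<pi> Q P \<longleftrightarrow>
     polytope P \<and> P \<subseteq> V \<and> rel_interior ` normal_fan V P = fiber_fan_open_cones V \<pi> Q"

definition config_proj :: "('n::finite \<Rightarrow> real^'d) \<Rightarrow> real^'n \<Rightarrow> (real^'d) \<times> real" where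
  "config_proj a x = (\<Sum>i\<in>UNIV. x $ i *\<^sub>R (a i, 1))"

definition coord_subspace :: "'n::finite set \<Rightarrow> (real^'n) set" where
  "coord_subspace J = {x. \<forall>i. i \<notin> J \<longrightarrow> x $ i = 0}"

definition hypersimplex :: "'n::finite set \<Rightarrow> nat \<Rightarrow> (real^'n) set" where
  "hypersimplex J k =
     {x \<in> coord_subspace J. (\<forall>i\<in>J. 0 \<le> x $ i \<and> x $ i \<le> 1) \<and> (\<Sum>i\<in>J. x $ i) = real k}"

(* P is a k-th hypersecondary polytope of the subconfiguration A_J, living in R^J,
   which is embedded in R^n by the coordinate inclusion. *)

definition is_hypersecondary_polytope ::
  "('n::finite \<Rightarrow> real^'d) \<Rightarrow> 'n set \<Rightarrow> nat \<Rightarrow> (real^'n) set \<Rightarrow> bool" where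
  "is_hypersecondary_polytope a J k P \<longleftrightarrow>
     is_fiber_polytope (coord_subspace J) (config_proj a) (hypersimplex J k) P"

definition is_secondary_polytope ::
  "('n::finite \<Rightarrow> real^'d) \<Rightarrow> 'n set \<Rightarrow> (real^'n) set \<Rightarrow> bool" where
  "is_secondary_polytope a J P \<longleftrightarrow> is_hypersecondary_polytope a J 1 P"

end

theory Submission imports Defs
begin

text \<open>
  Two weights \<open>w\<close>, \<open>v\<close> lie in the same cone of the \<open>k\<close>-th fiber fan iff the same pairs
  \<open>(X, E)\<close> with \<open>card X < k < card X + card E\<close> (or \<open>E = {}\<close> and \<open>card X = k\<close>) are separated by an
  affine function \<open>l\<close> with \<open>w \<le> l\<close> on \<open>X\<close>, \<open>w = l\<close> on \<open>E\<close> and \<open>w \<ge> l\<close> elsewhere. Because the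
  fiber polytope exists, its cones are convex. So if \<open>w\<close> and \<open>v\<close> are equivalent for one fan but not
  for the other, one can move from \<open>w\<close> towards \<open>v\<close>, within the first cone, until some pair is about to
  be lost. By Farkas' lemma there is then a circuit \<open>u\<close> of the configuration, with \<open>u \<bullet> v < 0\<close>, whose
  lifted points lie on the graph of the affine function \<open>l\<close> of the current weight.
  Rotating \<open>l\<close> about the support of \<open>u\<close>, which has at most \<open>d + 2\<close> points, produces a pair of the
  first fan with the support of \<open>u\<close> contained in \<open>E\<close>: going from \<open>k\<close> to \<open>J\<close>, the at most
  \<open>n - s \<le> k - 1\<close> points below \<open>l\<close> form \<open>X\<close>, and \<open>k + 1 \<le> d + 2\<close> points weakly below are reached;
  going from the sets \<open>J\<close> to \<open>k\<close>, at least \<open>s = max (n - k + 1) (d + 2)\<close> points weakly above are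
  reached, and \<open>J\<close> is chosen among them. That pair also being supported for \<open>v\<close> forces
  \<open>u \<bullet> v = 0\<close>, a contradiction.
\<close>

section \<open>Faces minimizing a linear functional\<close>

lemma min_faceD: "x \<in> min_face Q w \<Longrightarrow> x \<in> Q" "x \<in> min_face Q w \<Longrightarrow> y \<in> Q \<Longrightarrow> w \<bullet> x \<le> w \<bullet> y"
  by (auto simp: min_face_def)

lemma min_face_subset: "min_face Q w \<subseteq> Q"
  by (auto simp: min_face_def)

lemma min_face_eqI:
  assumes "x \<in> min_face Q w"
  shows "min_face Q w = Q \<inter> {y. w \<bullet> y = w \<bullet> x}"
  using assms unfolding min_face_def by (auto intro: order_antisym)

lemma min_face_nonempty:
  assumes "compact Q" "Q \<noteq> {}"
  shows "min_face Q w \<noteq> {}"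
proof -
  have "continuous_on Q (\<lambda>x. w \<bullet> x)" by (intro continuous_intros)
  from continuous_attains_inf[OF assms this] show ?thesis
    by (auto simp: min_face_def)
qed

lemma min_face_face_of:
  assumes "convex Q"
  shows "min_face Q w face_of Q"
proof (cases "min_face Q w = {}")
  case False
  then obtain x where x: "x \<in> min_face Q w" by blast
  then have "Q \<inter> {y. w \<bullet> y = w \<bullet> x} face_of Q"
    by (intro face_of_Int_supporting_hyperplane_ge[OF assms]) (auto simp: min_face_def)
  then show ?thesis by (simp only: min_face_eqI[OF x])
qed (simp add: empty_face_of)

lemma polytope_min_face: "polytope Q \<Longrightarrow> polytope (min_face Q w)"
  by (meson face_of_polytope_polytope min_face_face_of polytope_imp_convex)

text \<open>Tie-breaking: a small multiple of \<open>c\<close> only selects among the minimizers of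
  \<open>v\<close>. Checking the finitely many generators gives a bound \<open>b\<close> below which
  a fixed \<open>g\<close> stays minimal; a point that ties with \<open>g\<close> at
  \<open>e\<close> and obeys the inequality at \<open>2 * e\<close> must already minimize
  \<open>v\<close>.\<close>

lemma min_face_perturb:
  assumes "polytope Q"
  obtains e where "e > 0" "min_face Q (v + e *\<^sub>R c) = min_face (min_face Q v) c"
proof (cases "Q = {}")
  case True
  then show ?thesis by (intro that[of 1]) (auto simp: min_face_def)
next
  case False
  obtain V where V: "finite V" "Q = convex hull V"
    using assms by (auto simp: polytope_def)
  have VQ: "V \<subseteq> Q" by (simp add: V(2) hull_subset)
  have "compact (min_face Q v)" "min_face Q v \<noteq> {}"
    by (simp_all add: assms False polytope_min_face polytope_imp_compact min_face_nonempty)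
  from min_face_nonempty[OF this, of c] obtain g where g: "g \<in> min_face (min_face Q v) c"
    by blast
  then have gG: "g \<in> min_face Q v" by (rule min_faceD)
  have "\<forall>\<^sub>F e in at_right (0::real). v \<bullet> g + e * (c \<bullet> g) \<le> v \<bullet> y + e * (c \<bullet> y)" if y: "y \<in> V" for y
  proof (cases "v \<bullet> y = v \<bullet> g")
    case True
    then have "y \<in> min_face Q v" using y VQ min_face_eqI[OF gG] by auto
    then have "c \<bullet> g \<le> c \<bullet> y" using g by (rule min_faceD(2)[rotated])
    with True show ?thesis
      by (intro eventually_at_right_less[THEN eventually_mono]) (auto intro: mult_left_mono)
  next
    case False
    then have "v \<bullet> g < v \<bullet> y" using gG y VQ min_faceD(2)[OF gG, of y] by auto
    moreover have "((\<lambda>e. v \<bullet> y + e * (c \<bullet> y) - (v \<bullet> g + e * (c \<bullet> g))) \<longlongrightarrow>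
       v \<bullet> y + 0 * (c \<bullet> y) - (v \<bullet> g + 0 * (c \<bullet> g))) (at_right 0)"
      by (intro tendsto_intros)
    ultimately have "\<forall>\<^sub>F e in at_right (0::real). 0 < v \<bullet> y + e * (c \<bullet> y) - (v \<bullet> g + e * (c \<bullet> g))"
      by (intro order_tendstoD(1)) auto
    then show ?thesis by eventually_elim auto
  qed
  then have "\<forall>\<^sub>F e in at_right (0::real). \<forall>y\<in>V. v \<bullet> g + e * (c \<bullet> g) \<le> v \<bullet> y + e * (c \<bullet> y)"
    using V(1) by (simp add: eventually_ball_finite)
  then obtain b where b: "b > 0"
    "\<And>e y. 0 < e \<Longrightarrow> e < b \<Longrightarrow> y \<in> V \<Longrightarrow> v \<bullet> g + e * (c \<bullet> g) \<le> v \<bullet> y + e * (c \<bullet> y)"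
    unfolding eventually_at_right_field by blast
  have bQ: "v \<bullet> g + e * (c \<bullet> g) \<le> v \<bullet> y + e * (c \<bullet> y)" if "0 < e" "e < b" "y \<in> Q" for e y
  proof -
    have "V \<subseteq> {y. (v + e *\<^sub>R c) \<bullet> y \<ge> v \<bullet> g + e * (c \<bullet> g)}"
      using b(2) that by (auto simp: inner_add_left)
    then have "Q \<subseteq> {y. (v + e *\<^sub>R c) \<bullet> y \<ge> v \<bullet> g + e * (c \<bullet> g)}"
      unfolding V(2) by (rule hull_minimal) (rule convex_halfspace_ge)
    then show ?thesis using that by (auto simp: inner_add_left)
  qed
  define e where "e = b / 3"
  have e: "0 < e" "e < b" "0 < 2 * e" "2 * e < b" using b(1) by (auto simp: e_def)
  have gQ: "g \<in> min_face Q (v + e *\<^sub>R c)"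
    using bQ[OF e(1,2)] min_faceD(1)[OF gG] by (auto simp: min_face_def inner_add_left)
  have "min_face Q (v + e *\<^sub>R c) = min_face (min_face Q v) c"
  proof safe
    fix x assume "x \<in> min_face Q (v + e *\<^sub>R c)"
    then have x: "x \<in> Q" "v \<bullet> x + e * (c \<bullet> x) = v \<bullet> g + e * (c \<bullet> g)"
      using min_face_eqI[OF gQ] by (auto simp: inner_add_left)
    have "v \<bullet> g + 2 * e * (c \<bullet> g) \<le> v \<bullet> x + 2 * e * (c \<bullet> x)"
      using bQ[OF e(3,4) x(1)] .
    then have "v \<bullet> x \<le> v \<bullet> g" using x(2) by (simp add: algebra_simps)
    then have vx: "v \<bullet> x = v \<bullet> g" using min_faceD(2)[OF gG x(1)] by simp
    then have "x \<in> min_face Q v" using min_face_eqI[OF gG] x by auto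
    moreover have "c \<bullet> x = c \<bullet> g" using x(2) vx e by auto
    ultimately show "x \<in> min_face (min_face Q v) c" using min_face_eqI[OF g] by auto
  next
    fix x assume "x \<in> min_face (min_face Q v) c"
    then have "x \<in> Q" "v \<bullet> x = v \<bullet> g" "c \<bullet> x = c \<bullet> g"
      using min_face_eqI[OF g] min_face_eqI[OF gG] by auto
    then show "x \<in> min_face Q (v + e *\<^sub>R c)"
      using min_face_eqI[OF gQ] by (auto simp: inner_add_left)
  qed
  then show ?thesis using e that by blast
qed

lemma min_face_cong:
  assumes "\<And>x y. x \<in> Q \<Longrightarrow> y \<in> Q \<Longrightarrow> w \<bullet> (x - y) = v \<bullet> (x - y)"
  shows "min_face Q w = min_face Q v"
proof -
  have "w \<bullet> x \<le> w \<bullet> y \<longleftrightarrow> v \<bullet> x \<le> v \<bullet> y" if "x \<in> Q" "y \<in> Q" for x y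
    using assms[OF that] by (simp add: inner_diff_right) linarith
  then show ?thesis by (auto simp: min_face_def)
qed

lemma min_face_between:
  assumes "min_face Q w \<subseteq> R" "R \<subseteq> Q" "min_face Q w \<noteq> {}"
  shows "min_face R w = min_face Q w"
proof -
  obtain x where x: "x \<in> min_face Q w" using assms(3) by blast
  then have "x \<in> min_face R w" using assms(1,2) by (auto simp: min_face_def)
  from min_face_eqI[OF this] min_face_eqI[OF x] assms(1,2) show ?thesis by auto
qed

lemma min_face_const:
  assumes "\<And>x y. x \<in> Q \<Longrightarrow> y \<in> Q \<Longrightarrow> w \<bullet> x = w \<bullet> y"
  shows "min_face Q w = Q"
  by (auto simp: min_face_def intro: eq_refl assms)

text \<open>At a common minimizer the excesses of any other point for \<open>w\<close> and
  \<open>v\<close> are nonnegative. One of \<open>t\<close> and \<open>1 - t\<close> is positive, so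
  a vanishing combination makes one excess vanish, and the equality of faces then handles the
  other.\<close>

lemma min_face_segment:
  assumes eq: "min_face P w = min_face P v" and ne: "min_face P w \<noteq> {}"
    and t: "0 \<le> t" "t \<le> 1"
  shows "min_face P ((1 - t) *\<^sub>R w + t *\<^sub>R v) = min_face P w"
proof -
  obtain x where x: "x \<in> min_face P w" using ne by blast
  then have x': "x \<in> min_face P v" using eq by simp
  let ?z = "(1 - t) *\<^sub>R w + t *\<^sub>R v"
  have le: "w \<bullet> x \<le> w \<bullet> y" "v \<bullet> x \<le> v \<bullet> y" if "y \<in> P" for y
    using min_faceD(2)[OF x that] min_faceD(2)[OF x' that] by auto
  have xz: "x \<in> min_face P ?z"
    using min_faceD(1)[OF x] le t
    by (auto simp: min_face_def inner_add_left intro!: add_mono mult_left_mono)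
  have "y \<in> min_face P w" if "y \<in> min_face P ?z" for y
  proof -
    have y: "y \<in> P" "(1 - t) * (w \<bullet> y - w \<bullet> x) + t * (v \<bullet> y - v \<bullet> x) = 0"
      using that min_face_eqI[OF xz] by (auto simp: inner_add_left algebra_simps)
    have "0 \<le> (1 - t) * (w \<bullet> y - w \<bullet> x)" "0 \<le> t * (v \<bullet> y - v \<bullet> x)"
      using le[OF y(1)] t by auto
    with y(2) have "(1 - t) * (w \<bullet> y - w \<bullet> x) = 0" "t * (v \<bullet> y - v \<bullet> x) = 0" by linarith+
    then have "w \<bullet> y = w \<bullet> x \<or> v \<bullet> y = v \<bullet> x" by auto
    then show ?thesis using eq min_face_eqI[OF x] min_face_eqI[OF x'] y(1) by auto
  qed
  moreover have "y \<in> min_face P ?z" if "y \<in> min_face P w" for y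
  proof -
    have "y \<in> P" "w \<bullet> y = w \<bullet> x" "v \<bullet> y = v \<bullet> x"
      using that eq min_face_eqI[OF x] min_face_eqI[OF x'] by auto
    then show ?thesis using min_face_eqI[OF xz] by (simp add: inner_add_left)
  qed
  ultimately show ?thesis by blast
qed

section \<open>Normal fans and coherent subdivisions\<close>

text \<open>Faces of a polytope are exposed, and projecting the exposing functional orthogonally to
  \<open>V\<close> keeps its values on \<open>P\<close>. The sign changes because \<open>a\<close>
  is maximal on \<open>F\<close>.\<close>

lemma face_of_polytope_min_face:
  assumes "polytope P" "P \<subseteq> V" "subspace V" "F face_of P" "F \<noteq> {}"
  obtains w where "w \<in> V" "F = min_face P w"
proof -
  have "F exposed_face_of P"
    using assms by (simp add: exposed_face_of_polyhedron polytope_imp_polyhedron)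
  then obtain a b where ab: "P \<subseteq> {x. a \<bullet> x \<le> b}" "F = P \<inter> {x. a \<bullet> x = b}"
    unfolding exposed_face_of_def by blast
  obtain y z where yz: "y \<in> span V" "\<And>x. x \<in> span V \<Longrightarrow> orthogonal z x" "- a = y + z"
    using orthogonal_subspace_decomp_exists[of V "- a"] by metis
  have y: "y \<bullet> x = - (a \<bullet> x)" if "x \<in> P" for x
  proof -
    have "z \<bullet> x = 0"
      using yz(2)[of x] that assms(2) span_superset[of V] by (auto simp: orthogonal_def)
    then have "(- a) \<bullet> x = y \<bullet> x" unfolding yz(3) by (simp add: inner_add_left)
    then show ?thesis by simp
  qed
  obtain x0 where x0: "x0 \<in> F" using assms(5) by blast
  have "x0 \<in> min_face P y" using x0 ab y by (auto simp: min_face_def)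
  then have "min_face P y = F" unfolding min_face_eqI[OF \<open>x0 \<in> min_face P y\<close>] using x0 ab y by auto
  moreover have "y \<in> V" using yz(1) assms(3) by (metis span_eq_iff)
  ultimately show ?thesis using that by blast
qed

lemma normal_cone_eq:
  assumes "F \<subseteq> P"
  shows "normal_cone V P F = V \<inter> (\<Inter>x\<in>F. \<Inter>y\<in>P. {w. (x - y) \<bullet> w \<le> 0})"
proof -
  have "(x - y) \<bullet> w \<le> 0 \<longleftrightarrow> w \<bullet> x \<le> w \<bullet> y" for x y w :: 'a
    by (simp add: inner_diff_left inner_commute[of w])
  then show ?thesis using assms by (auto simp: normal_cone_def min_face_def)
qed

lemma convex_normal_cone:
  assumes "subspace V" "F \<subseteq> P"
  shows "convex (normal_cone V P F)"
  unfolding normal_cone_eq[OF assms(2)]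
  by (intro convex_Int convex_INT convex_halfspace_le subspace_imp_convex assms(1))

lemma closed_normal_cone:
  assumes "subspace V" "F \<subseteq> P"
  shows "closed (normal_cone V P F)"
  unfolding normal_cone_eq[OF assms(2)]
  by (intro closed_Int closed_INT ballI closed_halfspace_le closed_subspace assms(1))

text \<open>A point \<open>z\<close> is relatively interior iff each segment from a point
  \<open>x\<close> of the cone to \<open>z\<close> extends beyond \<open>z\<close>. If the faces
  agree, \<open>z - x\<close> is constant on the face, so a perturbation in this direction preserves
  it. Conversely, extending the segment from \<open>w\<close> shows that minimizers of
  \<open>z\<close> minimize \<open>w\<close>.\<close>

lemma rel_interior_normal_cone:
  assumes "polytope P" "P \<noteq> {}" "subspace V" "w \<in> V"
  shows "rel_interior (normal_cone V P (min_face P w)) = {v \<in> V. min_face P v = min_face P w}"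
    (is "rel_interior ?C = ?R")
proof -
  let ?F = "min_face P w"
  have ne: "?F \<noteq> {}"
    using assms by (simp add: min_face_nonempty polytope_imp_compact)
  then obtain f where f: "f \<in> ?F" by blast
  have w: "w \<in> ?C" using assms by (simp add: normal_cone_def)
  have iff: "z \<in> rel_interior ?C \<longleftrightarrow> (\<forall>x\<in>?C. \<exists>e. e > 1 \<and> (1 - e) *\<^sub>R x + e *\<^sub>R z \<in> ?C)" for z
    using w by (intro convex_rel_interior_iff convex_normal_cone assms(3) min_face_subset) auto
  have "z \<in> rel_interior ?C" if z: "z \<in> ?R" for z
    unfolding iff
  proof
    fix x assume x: "x \<in> ?C"
    obtain e where e: "e > 0" "min_face P (z + e *\<^sub>R (z - x)) = min_face (min_face P z) (z - x)"
      using min_face_perturb[OF assms(1)] by blast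
    have const: "u \<bullet> p = u \<bullet> q" if "u \<in> ?C" "p \<in> ?F" "q \<in> ?F" for u p q
    proof -
      have "p \<in> min_face P u" "q \<in> min_face P u" using that by (auto simp: normal_cone_def)
      then show ?thesis by (auto simp: min_face_def intro: order_antisym)
    qed
    have zC: "z \<in> ?C" using z by (auto simp: normal_cone_def)
    have zF: "min_face P z = ?F" using z by simp
    have "min_face (min_face P z) (z - x) = ?F"
      unfolding zF
    proof (rule min_face_const)
      fix p q assume "p \<in> ?F" "q \<in> ?F"
      then show "(z - x) \<bullet> p = (z - x) \<bullet> q"
        using const[OF zC] const[OF x] unfolding inner_diff_left by metis
    qed
    moreover have "z + e *\<^sub>R (z - x) \<in> V"
      using z x assms(3) by (auto simp: normal_cone_def intro!: subspace_add subspace_mul subspace_diff)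
    ultimately have "z + e *\<^sub>R (z - x) \<in> ?C" using e by (auto simp: normal_cone_def)
    moreover have "z + e *\<^sub>R (z - x) = (1 - (1 + e)) *\<^sub>R x + (1 + e) *\<^sub>R z"
      by (simp add: algebra_simps)
    ultimately show "\<exists>e. e > 1 \<and> (1 - e) *\<^sub>R x + e *\<^sub>R z \<in> ?C"
      using e(1) by (intro exI[of _ "1 + e"]) simp
  qed
  moreover have "z \<in> ?R" if z: "z \<in> rel_interior ?C" for z
  proof -
    have zC: "z \<in> ?C" using z rel_interior_subset[of ?C] by (rule subsetD[rotated])
    obtain e where e: "e > 1" "(1 - e) *\<^sub>R w + e *\<^sub>R z \<in> ?C"
      using bspec[OF iff[THEN iffD1, OF z] w] by auto
    have fz: "f \<in> min_face P z" "f \<in> min_face P ((1 - e) *\<^sub>R w + e *\<^sub>R z)"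
      using zC e f by (auto simp: normal_cone_def)
    have "x \<in> ?F" if x: "x \<in> min_face P z" for x
    proof -
      have xP: "x \<in> P" "z \<bullet> x = z \<bullet> f" using x min_face_eqI[OF fz(1)] by auto
      have "(1 - e) * (w \<bullet> f) \<le> (1 - e) * (w \<bullet> x)"
        using min_faceD(2)[OF fz(2) xP(1)] xP(2) by (simp add: inner_add_left)
      then have "w \<bullet> x \<le> w \<bullet> f" using e(1) by (simp add: mult_le_cancel_left)
      then have "w \<bullet> x = w \<bullet> f" using min_faceD(2)[OF f xP(1)] by simp
      then show ?thesis using min_face_eqI[OF f] xP by auto
    qed
    then show ?thesis using zC by (auto simp: normal_cone_def)
  qed
  ultimately show ?thesis by blast
qed

lemma normal_fan_eq:
  assumes "polytope P" "P \<noteq> {}" "P \<subseteq> V" "subspace V"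
  shows "normal_fan V P = (\<lambda>w. normal_cone V P (min_face P w)) ` V"
proof -
  have "normal_cone V P F \<in> (\<lambda>w. normal_cone V P (min_face P w)) ` V"
    if "F face_of P" "F \<noteq> {}" for F
    using face_of_polytope_min_face[OF assms(1,3,4) that] by blast
  moreover have "normal_cone V P (min_face P w) \<in> normal_fan V P" for w
  proof -
    have "min_face P w face_of P" "min_face P w \<noteq> {}"
      using assms by (simp_all add: min_face_face_of min_face_nonempty polytope_imp_convex polytope_imp_compact)
    then show ?thesis unfolding normal_fan_def by blast
  qed
  ultimately show ?thesis by (auto simp: normal_fan_def)
qed

lemma rel_interior_normal_fan:
  assumes "polytope P" "P \<noteq> {}" "P \<subseteq> V" "subspace V"
  shows "rel_interior ` normal_fan V P = (\<lambda>w. {v \<in> V. min_face P v = min_face P w}) ` V"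
  unfolding normal_fan_eq[OF assms] image_image
  by (intro image_cong refl rel_interior_normal_cone assms)

text \<open>Closed convex cones are the closures of their relative interiors, so the fan depends
  only on which functionals have equal minimal faces.\<close>

lemma normal_fan_eq_closure:
  assumes "polytope P" "P \<noteq> {}" "P \<subseteq> V" "subspace V"
  shows "normal_fan V P = (\<lambda>w. closure {v \<in> V. min_face P v = min_face P w}) ` V"
proof -
  have "closure {v \<in> V. min_face P v = min_face P w} = normal_cone V P (min_face P w)"
    if "w \<in> V" for w
    using convex_closure_rel_interior[OF convex_normal_cone[OF assms(4) min_face_subset]]
      closed_normal_cone[OF assms(4) min_face_subset] rel_interior_normal_cone[OF assms(1,2,4) that]
    by (metis closure_closed)
  then show ?thesis unfolding normal_fan_eq[OF assms] by (auto simp: image_def)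
qed

lemma normally_equivalentI:
  assumes "polytope P" "P \<noteq> {}" "polytope Q" "Q \<noteq> {}"
    and "\<And>v w. min_face P v = min_face P w \<longleftrightarrow> min_face Q v = min_face Q w"
  shows "normally_equivalent P Q"
  unfolding normally_equivalent_def
  using assms by (simp add: normal_fan_eq_closure)

text \<open>The empty polytope has an empty normal fan, whereas the fiber fan always has the cone of
  \<open>0\<close>.\<close>

lemma fiber_polytope_nonempty:
  assumes "is_fiber_polytope V \<pi> Q P" "subspace V"
  shows "P \<noteq> {}"
proof
  assume "P = {}"
  then have "normal_fan V P = {}" by (auto simp: normal_fan_def dest: face_of_imp_subset)
  with assms show False
    by (auto simp: is_fiber_polytope_def fiber_fan_open_cones_def dest: subspace_0)
qed

text \<open>Both families consist of the classes of an equivalence relation on \<open>V\<close>, so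
  their equality identifies the relations. The class of \<open>w\<close> is only known to be that of
  some \<open>u\<close>, with which both weights are then compared.\<close>

lemma fiber_polytope_min_face_iff:
  assumes P: "is_fiber_polytope V \<pi> Q P" and V: "subspace V" and wv: "w \<in> V" "v \<in> V"
  shows "min_face P w = min_face P v \<longleftrightarrow> coherent_subdivision V \<pi> Q w = coherent_subdivision V \<pi> Q v"
proof -
  have eq: "(\<lambda>w. {v \<in> V. min_face P v = min_face P w}) ` V = fiber_fan_open_cones V \<pi> Q"
    using P fiber_polytope_nonempty[OF P V] rel_interior_normal_fan[of P V] V
    by (auto simp: is_fiber_polytope_def)
  have "{v \<in> V. min_face P v = min_face P w} \<in> fiber_fan_open_cones V \<pi> Q"
    unfolding eq[symmetric] using wv by blast
  then obtain u where
    "{v \<in> V. min_face P v = min_face P w} =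
     {v \<in> V. coherent_subdivision V \<pi> Q v = coherent_subdivision V \<pi> Q u}"
    unfolding fiber_fan_open_cones_def by blast
  then have "min_face P x = min_face P w \<longleftrightarrow>
     coherent_subdivision V \<pi> Q x = coherent_subdivision V \<pi> Q u" if "x \<in> V" for x
    using that by blast
  from this[OF wv(1)] this[OF wv(2)] show ?thesis by auto
qed

text \<open>
  A coherent subdivision is determined by the union of its cells: a cell \<open>F\<close> of \<open>w\<close> lies in a cell
  \<open>G\<close> of \<open>v\<close>, which lies in a cell \<open>F'\<close> of \<open>w\<close>; since \<open>F\<close> is cut out of \<open>F'\<close> by a functional
  vanishing on the kernel of \<open>\<pi>\<close>, perturbing \<open>G\<close> by this functional shows that \<open>F\<close> is a cell of \<open>v\<close>.
\<close>
lemma coherent_subdivision_eq_iff: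
  fixes \<pi> :: "'a::euclidean_space \<Rightarrow> 'b::real_vector"
  assumes Q: "polytope Q" and V: "subspace V" and wv: "w \<in> V" "v \<in> V"
  defines "U \<equiv> \<lambda>u y. \<exists>u'\<in>V. (\<forall>x\<in>V. \<pi> x = 0 \<longrightarrow> u' \<bullet> x = u \<bullet> x) \<and> y \<in> min_face Q u'"
  shows "coherent_subdivision V \<pi> Q w = coherent_subdivision V \<pi> Q v \<longleftrightarrow> (\<forall>y\<in>Q. U w y \<longleftrightarrow> U v y)"
proof
  define cell where "cell u F \<longleftrightarrow>
    (\<exists>u'\<in>V. (\<forall>x\<in>V. \<pi> x = 0 \<longrightarrow> u' \<bullet> x = u \<bullet> x) \<and> min_face Q u' = F)" for u F
  have coh: "coherent_subdivision V \<pi> Q u = {(\<pi> ` F, F) | F. cell u F}" for u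
    unfolding coherent_subdivision_def cell_def ..
  have U: "U u y \<longleftrightarrow> (\<exists>F. cell u F \<and> y \<in> F)" for u y
    unfolding U_def cell_def by blast
  assume "coherent_subdivision V \<pi> Q w = coherent_subdivision V \<pi> Q v"
  then have "cell w F \<longleftrightarrow> cell v F" for F unfolding coh by blast
  then show "\<forall>y\<in>Q. U w y \<longleftrightarrow> U v y" unfolding U by blast
next
  have *: "coherent_subdivision V \<pi> Q w \<subseteq> coherent_subdivision V \<pi> Q v"
    if U_eq: "\<forall>y\<in>Q. U w y \<longleftrightarrow> U v y" and v: "v \<in> V" for w v
  proof
    fix C assume "C \<in> coherent_subdivision V \<pi> Q w"
    then obtain w' where w': "w' \<in> V" "\<forall>x\<in>V. \<pi> x = 0 \<longrightarrow> w' \<bullet> x = w \<bullet> x"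
      and C: "C = (\<pi> ` min_face Q w', min_face Q w')"
      unfolding coherent_subdivision_def by blast
    \<comment> \<open>A face of \<open>Q\<close> that meets the relative interior of a convex subset
      contains the subset, so the cell through one relative interior point contains the whole
      face.\<close>
    have step: "\<exists>u'\<in>V. (\<forall>x\<in>V. \<pi> x = 0 \<longrightarrow> u' \<bullet> x = u \<bullet> x) \<and> min_face Q z \<subseteq> min_face Q u'"
      if z: "z \<in> V" and cell: "\<And>y. y \<in> min_face Q z \<Longrightarrow> U u y" and ne: "min_face Q z \<noteq> {}" for u z
    proof -
      have "convex (min_face Q z)"
        by (intro polytope_imp_convex polytope_min_face Q)
      then obtain y where y: "y \<in> rel_interior (min_face Q z)"
        using ne rel_interior_eq_empty[of "min_face Q z"] by blast
      then have "y \<in> min_face Q z" using rel_interior_subset[of "min_face Q z"] by blast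
      from cell[OF this] obtain u' where u': "u' \<in> V" "\<forall>x\<in>V. \<pi> x = 0 \<longrightarrow> u' \<bullet> x = u \<bullet> x" "y \<in> min_face Q u'"
        unfolding U_def by blast
      have "min_face Q z \<subseteq> min_face Q u'"
        by (rule subset_of_face_of[OF min_face_face_of[OF polytope_imp_convex[OF Q]] min_face_subset])
          (use y u' in blast)
      then show ?thesis using u' by blast
    qed
    show "C \<in> coherent_subdivision V \<pi> Q v"
    proof (cases "min_face Q w' = {}")
      case True
      then have "Q = {}" using Q min_face_nonempty polytope_imp_compact by metis
      then have "min_face Q v = {}" by (simp add: min_face_def)
      then show ?thesis using C True v unfolding coherent_subdivision_def by auto
    next
      case False
      have Uw: "U w y" if "y \<in> min_face Q w'" for y
        using that w' unfolding U_def by blast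
      then have "U v y" if "y \<in> min_face Q w'" for y
        using U_eq that min_face_subset by blast
      then obtain v' where v': "v' \<in> V" "\<forall>x\<in>V. \<pi> x = 0 \<longrightarrow> v' \<bullet> x = v \<bullet> x"
          "min_face Q w' \<subseteq> min_face Q v'"
        using step[OF w'(1) _ False] by blast
      then have ne: "min_face Q v' \<noteq> {}" using False by blast
      have "U w y" if "y \<in> min_face Q v'" for y
        using U_eq that min_face_subset v' unfolding U_def by blast
      then obtain w'' where w'': "w'' \<in> V" "\<forall>x\<in>V. \<pi> x = 0 \<longrightarrow> w'' \<bullet> x = w \<bullet> x"
          "min_face Q v' \<subseteq> min_face Q w''"
        using step[OF v'(1) _ ne] by blast
      \<comment> \<open>Both functionals agree with \<open>w\<close> on the kernel of
        \<open>\<pi>\<close>, so \<open>c\<close> vanishes there. As \<open>w''\<close> is constant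
        on the face of \<open>v'\<close>, \<open>c\<close> and \<open>w'\<close> have the same
        minimizers on it.\<close>
      define c where "c = w' - w''"
      have "min_face (min_face Q v') c = min_face (min_face Q v') w'"
      proof (rule min_face_cong)
        fix x y assume "x \<in> min_face Q v'" "y \<in> min_face Q v'"
        then have "x \<in> min_face Q w''" "y \<in> min_face Q w''" using w''(3) by auto
        then have "w'' \<bullet> x = w'' \<bullet> y" by (auto simp: min_face_def intro: order_antisym)
        then show "c \<bullet> (x - y) = w' \<bullet> (x - y)" by (simp add: c_def inner_diff_left inner_diff_right)
      qed
      also have "\<dots> = min_face Q w'"
        using v'(3) False min_face_subset by (intro min_face_between)
      finally have c: "min_face (min_face Q v') c = min_face Q w'" .
      obtain e where e: "min_face Q (v' + e *\<^sub>R c) = min_face (min_face Q v') c"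
        using min_face_perturb[OF Q] by blast
      have "v' + e *\<^sub>R c \<in> V"
        unfolding c_def using V v' w' w'' by (intro subspace_add subspace_mul subspace_diff)
      moreover have "\<forall>x\<in>V. \<pi> x = 0 \<longrightarrow> (v' + e *\<^sub>R c) \<bullet> x = v \<bullet> x"
        using v' w' w'' by (auto simp: c_def inner_add_left inner_diff_left)
      moreover have "C = (\<pi> ` min_face Q (v' + e *\<^sub>R c), min_face Q (v' + e *\<^sub>R c))"
        unfolding C e c ..
      ultimately show ?thesis unfolding coherent_subdivision_def by blast
    qed
  qed
  show "coherent_subdivision V \<pi> Q w = coherent_subdivision V \<pi> Q v" if "\<forall>y\<in>Q. U w y \<longleftrightarrow> U v y"
    using *[OF that wv(2)] *[of v w] that wv(1) by simp
qed

section \<open>Minimal faces of Minkowski sums\<close>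

lemma min_face_plus_iff:
  assumes "compact P" "P \<noteq> {}" "compact Q" "Q \<noteq> {}"
  shows "min_face (P + Q) v = min_face (P + Q) w \<longleftrightarrow>
    min_face P v = min_face P w \<and> min_face Q v = min_face Q w"
proof -
  \<comment> \<open>Since this splits for every pair, fixing one summand recovers the face of the
    other; it serves as a cancellation law for the faces.\<close>
  have mem: "p + q \<in> min_face (P + Q) u \<longleftrightarrow> p \<in> min_face P u \<and> q \<in> min_face Q u"
    if pq: "p \<in> P" "q \<in> Q" for p q u
  proof
    assume *: "p + q \<in> min_face (P + Q) u"
    have "u \<bullet> p \<le> u \<bullet> y" if "y \<in> P" for y
      using min_faceD(2)[OF *, of "y + q"] that pq by (auto simp: inner_add_right)
    moreover have "u \<bullet> q \<le> u \<bullet> y" if "y \<in> Q" for y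
      using min_faceD(2)[OF *, of "p + y"] that pq by (auto simp: inner_add_right)
    ultimately show "p \<in> min_face P u \<and> q \<in> min_face Q u"
      using pq by (auto simp: min_face_def)
  next
    assume "p \<in> min_face P u \<and> q \<in> min_face Q u"
    then show "p + q \<in> min_face (P + Q) u"
      by (auto simp: min_face_def set_plus_def inner_add_right intro!: add_mono)
  qed
  have sum: "min_face (P + Q) u = min_face P u + min_face Q u" for u
  proof -
    have "x \<in> min_face P u + min_face Q u" if x: "x \<in> min_face (P + Q) u" for x
    proof -
      obtain p q where "p \<in> P" "q \<in> Q" "x = p + q"
        using min_faceD(1)[OF x] by (auto simp: set_plus_def)
      then show ?thesis using x mem by (auto simp: set_plus_def)
    qed
    moreover have "x \<in> min_face (P + Q) u" if x: "x \<in> min_face P u + min_face Q u" for x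
    proof -
      obtain p q where "p \<in> min_face P u" "q \<in> min_face Q u" "x = p + q"
        using x by (auto simp: set_plus_def)
      then show ?thesis using mem[of p q u] by (simp add: min_faceD(1))
    qed
    ultimately show ?thesis by blast
  qed
  have ne: "min_face P u \<noteq> {}" "min_face Q u \<noteq> {}" for u
    using assms by (auto simp: min_face_nonempty)
  have "min_face P v \<subseteq> min_face P w" "min_face Q v \<subseteq> min_face Q w"
    if eq: "min_face (P + Q) v = min_face (P + Q) w" for v w
  proof -
    have "p \<in> min_face P w \<and> q \<in> min_face Q w" if "p \<in> min_face P v" "q \<in> min_face Q v" for p q
      using that mem[of p q v] mem[of p q w] eq min_faceD(1) by blast
    then show "min_face P v \<subseteq> min_face P w" "min_face Q v \<subseteq> min_face Q w"
      using ne[of v] by blast+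
  qed
  then show ?thesis using sum by (metis subset_antisym)
qed

lemma polytope_set_plus:
  assumes "polytope P" "polytope Q"
  shows "polytope (P + Q)"
proof -
  have "P + Q = (\<lambda>(x, y). x + y) ` (P \<times> Q)" by (auto simp: set_plus_def)
  moreover have "linear (\<lambda>(x, y). x + y :: 'a)"
    by (intro linearI) (auto simp: algebra_simps)
  ultimately show ?thesis using assms by (simp add: polytope_Times polytope_linear_image)
qed

text \<open>The induction carries along that the sum is a nonempty polytope, because
  \<open>min_face_plus_iff\<close> asks for compact nonempty summands. The empty sum is
  \<open>{0}\<close>.\<close>

lemma min_face_sum_iff:
  fixes F :: "'i \<Rightarrow> 'a::euclidean_space set"
  assumes "finite I" "\<And>i. i \<in> I \<Longrightarrow> polytope (F i)" "\<And>i. i \<in> I \<Longrightarrow> F i \<noteq> {}"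
  shows "polytope (\<Sum>i\<in>I. F i) \<and> (\<Sum>i\<in>I. F i) \<noteq> {} \<and>
    (\<forall>v w. min_face (\<Sum>i\<in>I. F i) v = min_face (\<Sum>i\<in>I. F i) w \<longleftrightarrow>
       (\<forall>i\<in>I. min_face (F i) v = min_face (F i) w))"
  using assms
proof (induction I rule: finite_induct)
  case empty
  have "polytope {0 :: 'a}" by (rule polytope_sing)
  then show ?case by (auto simp: min_face_def set_zero)
next
  case (insert i I)
  then have IH: "polytope (\<Sum>i\<in>I. F i)" "(\<Sum>i\<in>I. F i) \<noteq> {}"
    "\<And>v w. min_face (\<Sum>i\<in>I. F i) v = min_face (\<Sum>i\<in>I. F i) w \<longleftrightarrow>
       (\<forall>i\<in>I. min_face (F i) v = min_face (F i) w)"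
    by auto
  have "F i + (\<Sum>i\<in>I. F i) \<noteq> {}"
    using IH(2) insert.prems(2)[of i] by (auto simp: set_plus_def)
  then show ?case
    using insert.hyps insert.prems IH
    by (simp add: polytope_set_plus min_face_plus_iff polytope_imp_compact)
qed

section \<open>Supporting affine functions and circuits\<close>

text \<open>The values at the points of the affine function with coefficients \<open>c\<close>. By
  \<open>inner_aff_vec\<close> this is the adjoint of \<open>config_proj a\<close>, so these vectors
  are orthogonal to all affine dependencies.\<close>

definition aff_vec :: "('n::finite \<Rightarrow> real^'d) \<Rightarrow> (real^'d) \<times> real \<Rightarrow> real^'n" where
  "aff_vec a c = (\<chi> i. c \<bullet> (a i, 1))"

text \<open>
  For a point \<open>y\<close> of a hypersimplex, \<open>X\<close> and \<open>E\<close> will be the coordinates equal to \<open>1\<close> and those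
  strictly between \<open>0\<close> and \<open>1\<close>; \<open>level\<close> below describes the pairs arising in this way.
\<close>
definition supported ::
  "('n::finite \<Rightarrow> real^'d) \<Rightarrow> 'n set \<Rightarrow> 'n set \<Rightarrow> 'n set \<Rightarrow> real^'n \<Rightarrow> bool" where
  "supported a J X E w \<longleftrightarrow> (\<exists>c. (\<forall>i\<in>X. w $ i \<le> aff_vec a c $ i) \<and> (\<forall>i\<in>E. w $ i = aff_vec a c $ i) \<and>
     (\<forall>i\<in>J - X - E. aff_vec a c $ i \<le> w $ i))"

text \<open>The dual sign pattern: a dependency with these signs has nonnegative inner product with
  every weight that supports the pair. The signs on \<open>E\<close> are free.\<close>

definition conforming :: "'n::finite set \<Rightarrow> 'n set \<Rightarrow> 'n set \<Rightarrow> real^'n \<Rightarrow> bool" where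
  "conforming J X E u \<longleftrightarrow> (\<forall>i. i \<notin> J \<longrightarrow> u $ i = 0) \<and> (\<forall>i\<in>X. u $ i \<le> 0) \<and> (\<forall>i\<in>J - X - E. 0 \<le> u $ i)"

definition vec_supp :: "real^'n::finite \<Rightarrow> 'n set" where
  "vec_supp u = {i. u $ i \<noteq> 0}"

definition circuit :: "('n::finite \<Rightarrow> real^'d) \<Rightarrow> real^'n \<Rightarrow> bool" where
  "circuit a u \<longleftrightarrow> config_proj a u = 0 \<and> u \<noteq> 0 \<and>
     (\<forall>z. config_proj a z = 0 \<and> z \<noteq> 0 \<and> vec_supp z \<subseteq> vec_supp u \<longrightarrow> vec_supp z = vec_supp u)"

lemma linear_config_proj: "linear (config_proj a)"
  by (intro linearI)
    (auto simp: config_proj_def scaleR_add_left sum.distrib scaleR_sum_right simp del: scaleR_Pair)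

lemma config_proj_minus: "config_proj a (- u) = - config_proj a u"
  and config_proj_diff: "config_proj a (u - v) = config_proj a u - config_proj a v"
  and config_proj_scaleR: "config_proj a (r *\<^sub>R u) = r *\<^sub>R config_proj a u"
  using linear_config_proj[of a] by (simp_all add: linear_neg linear_diff linear_cmul)

lemma aff_vec_add: "aff_vec a (c + d) = aff_vec a c + aff_vec a d"
  and aff_vec_scaleR: "aff_vec a (r *\<^sub>R c) = r *\<^sub>R aff_vec a c"
  and aff_vec_minus: "aff_vec a (- c) = - aff_vec a c"
  and aff_vec_zero: "aff_vec a 0 = 0"
  by (simp_all add: aff_vec_def vec_eq_iff inner_add_left)

lemma inner_aff_vec: "u \<bullet> aff_vec a c = c \<bullet> config_proj a u"
  by (simp add: inner_vec_def[of u] aff_vec_def config_proj_def inner_sum_right del: scaleR_Pair)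

lemma vec_supp_empty_iff: "vec_supp u = {} \<longleftrightarrow> u = 0"
  by (auto simp: vec_supp_def vec_eq_iff)

text \<open>A hyperplane strictly separates \<open>v\<close> from the closed cone, at a level
  \<open>b < 0\<close> since the cone contains \<open>0\<close>. A generator with negative value
  could be scaled to reach the level \<open>b\<close>.\<close>

lemma farkas_convex_cone_hull:
  fixes S :: "'a::euclidean_space set"
  assumes "finite S" "v \<notin> convex_cone hull S"
  obtains u where "u \<bullet> v < 0" "\<And>x. x \<in> S \<Longrightarrow> 0 \<le> u \<bullet> x"
proof -
  obtain u b where ub: "u \<bullet> v < b" "\<And>x. x \<in> convex_cone hull S \<Longrightarrow> b < u \<bullet> x"
    using separating_hyperplane_closed_point[OF convex_convex_cone_hull closed_convex_cone_hull[OF assms(1)] assms(2)]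
    by blast
  have b: "b < 0" using ub(2)[OF convex_cone_hull_contains_0] by simp
  have "0 \<le> u \<bullet> x" if x: "x \<in> S" for x
  proof (rule ccontr)
    assume neg: "\<not> 0 \<le> u \<bullet> x"
    have "(b / (u \<bullet> x)) *\<^sub>R x \<in> convex_cone hull S"
      using neg b x by (intro convex_cone_hull_mul hull_inc) (auto simp: divide_nonpos_neg)
    from ub(2)[OF this] neg show False by simp
  qed
  moreover have "u \<bullet> v < 0" using ub(1) b by linarith
  ultimately show ?thesis using that by blast
qed

text \<open>The supporting weights form a convex cone containing \<open>S\<close>, so
  \<open>v\<close> lies outside the cone hull of \<open>S\<close>. Nonnegativity of the separating
  functional on each generator reads off one condition on \<open>u\<close>.\<close>

lemma supported_farkas:
  fixes a :: "'n::finite \<Rightarrow> real^'d"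
  assumes XE: "X \<inter> E = {}" "X \<union> E \<subseteq> J" and not: "\<not> supported a J X E v"
  obtains u where "config_proj a u = 0" "conforming J X E u" "u \<bullet> v < 0"
proof -
  \<comment> \<open>Outside \<open>J\<close> both signs of the unit vectors occur, as weights are
    unrestricted there; this forces \<open>u\<close> to vanish outside \<open>J\<close>.\<close>
  define S :: "(real^'n) set" where "S = aff_vec a ` Basis \<union> (\<lambda>c. aff_vec a (- c)) ` Basis \<union>
    (\<lambda>i. axis i 1) ` (- X - E) \<union> (\<lambda>i. - axis i 1) ` (X \<union> - J)"
  have "supported a J X E x" if x: "x \<in> S" for x
  proof -
    consider c where "x = aff_vec a c" | i where "x = axis i 1" "i \<notin> X" "i \<notin> E"
      | i where "x = - axis i 1" "i \<in> X \<union> - J"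
      using x unfolding S_def by blast
    then show ?thesis
    proof cases
      case 1
      then show ?thesis unfolding supported_def by (intro exI[of _ c]) auto
    next
      case 2
      then show ?thesis unfolding supported_def by (intro exI[of _ 0]) (auto simp: aff_vec_zero axis_def)
    next
      case 3
      then show ?thesis unfolding supported_def
        using XE by (intro exI[of _ 0]) (auto simp: aff_vec_zero axis_def)
    qed
  qed
  moreover have "convex_cone {x. supported a J X E x}"
    unfolding convex_cone_iff
  proof (intro conjI ballI allI impI)
    show "0 \<in> {x. supported a J X E x}"
      unfolding supported_def mem_Collect_eq by (intro exI[of _ 0]) (auto simp: aff_vec_zero)
  next
    fix x y assume "x \<in> {x. supported a J X E x}" "y \<in> {x. supported a J X E x}"
    then obtain c d where "(\<forall>i\<in>X. x $ i \<le> aff_vec a c $ i) \<and> (\<forall>i\<in>E. x $ i = aff_vec a c $ i) \<and>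
     (\<forall>i\<in>J - X - E. aff_vec a c $ i \<le> x $ i)"
      "(\<forall>i\<in>X. y $ i \<le> aff_vec a d $ i) \<and> (\<forall>i\<in>E. y $ i = aff_vec a d $ i) \<and>
     (\<forall>i\<in>J - X - E. aff_vec a d $ i \<le> y $ i)"
      unfolding supported_def by blast
    then show "x + y \<in> {x. supported a J X E x}"
      unfolding supported_def mem_Collect_eq
      by (intro exI[of _ "c + d"]) (auto simp: aff_vec_add intro!: add_mono)
  next
    fix x and r :: real assume "x \<in> {x. supported a J X E x}" "0 \<le> r"
    then obtain c where "(\<forall>i\<in>X. x $ i \<le> aff_vec a c $ i) \<and> (\<forall>i\<in>E. x $ i = aff_vec a c $ i) \<and>
     (\<forall>i\<in>J - X - E. aff_vec a c $ i \<le> x $ i)"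
      unfolding supported_def by blast
    with \<open>0 \<le> r\<close> show "r *\<^sub>R x \<in> {x. supported a J X E x}"
      unfolding supported_def mem_Collect_eq
      by (intro exI[of _ "r *\<^sub>R c"]) (auto simp: aff_vec_scaleR intro!: mult_left_mono)
  qed
  ultimately have "convex_cone hull S \<subseteq> {x. supported a J X E x}"
    by (intro hull_minimal) auto
  with not have "v \<notin> convex_cone hull S" by blast
  moreover have "finite S" by (simp add: S_def)
  ultimately obtain u where u: "u \<bullet> v < 0" "\<And>x. x \<in> S \<Longrightarrow> 0 \<le> u \<bullet> x"
    using farkas_convex_cone_hull by metis
  have "config_proj a u \<bullet> c = 0" if "c \<in> Basis" for c
  proof -
    have "aff_vec a c \<in> S" "aff_vec a (- c) \<in> S" using that unfolding S_def by blast+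
    then have "0 \<le> c \<bullet> config_proj a u" "0 \<le> (- c) \<bullet> config_proj a u"
      using u(2) inner_aff_vec by metis+
    then show ?thesis by (simp add: inner_commute[of c])
  qed
  then have "config_proj a u = 0" by (simp add: euclidean_eq_iff[of "config_proj a u"])
  moreover have pos: "0 \<le> u $ i" if "i \<notin> X" "i \<notin> E" for i
  proof -
    have "axis i 1 \<in> S" using that unfolding S_def by blast
    from u(2)[OF this] show ?thesis by (simp add: inner_axis)
  qed
  moreover have neg: "u $ i \<le> 0" if "i \<in> X \<union> - J" for i
  proof -
    have "- axis i 1 \<in> S" using that unfolding S_def by blast
    from u(2)[OF this] show ?thesis by (simp add: inner_axis)
  qed
  have "conforming J X E u"
    unfolding conforming_def
  proof (intro conjI allI ballI impI)
    fix i assume "i \<notin> J"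
    then show "u $ i = 0" using pos[of i] neg[of i] XE by auto
  qed (use pos neg in auto)
  ultimately show ?thesis using that u(1) by blast
qed

text \<open>Subtract the largest multiple of \<open>z\<close> that reverses no sign of
  \<open>u\<close>: the least ratio over the coordinates of equal sign. The minimizing coordinate is
  cancelled.\<close>

lemma vec_supp_reduce:
  assumes sub: "vec_supp z \<subseteq> vec_supp u" and pos: "z $ k * u $ k > 0"
  obtains r where "r > 0" "vec_supp (u - r *\<^sub>R z) \<subset> vec_supp u"
    "\<And>i. (u - r *\<^sub>R z) $ i * u $ i \<ge> 0"
proof -
  define T where "T = (\<lambda>i. u $ i / z $ i) ` {i. z $ i * u $ i > 0}"
  have T: "finite T" "T \<noteq> {}" using pos by (auto simp: T_def)
  define r where "r = Min T"
  obtain j where j: "z $ j * u $ j > 0" "r = u $ j / z $ j"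
    using Min_in[OF T] by (auto simp: T_def r_def)
  have r: "r > 0" using j by (simp add: zero_less_divide_iff zero_less_mult_iff) auto
  have nonneg: "(u - r *\<^sub>R z) $ i * u $ i \<ge> 0" for i
  proof (cases "z $ i * u $ i > 0")
    case True
    then have "r \<le> u $ i / z $ i" unfolding r_def by (intro Min_le T) (auto simp: T_def)
    then have "0 \<le> (u $ i / z $ i - r) * (z $ i * u $ i)" using True by simp
    also have "\<dots> = (u $ i / z $ i * z $ i - r * z $ i) * u $ i" by (simp add: algebra_simps)
    also have "u $ i / z $ i * z $ i = u $ i" using True by auto
    finally show ?thesis by simp
  next
    case False
    then have "0 \<le> u $ i * u $ i - r * (z $ i * u $ i)"
      using r by (smt (verit) mult_nonneg_nonpos zero_le_square)
    then show ?thesis by (simp add: algebra_simps)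
  qed
  have "j \<in> vec_supp u" "j \<notin> vec_supp (u - r *\<^sub>R z)" using j by (auto simp: vec_supp_def)
  moreover have "vec_supp (u - r *\<^sub>R z) \<subseteq> vec_supp u"
    using sub by (auto simp: vec_supp_def)
  ultimately show ?thesis using r nonneg that by blast
qed

lemma conforming_mono:
  assumes u: "conforming J X E u" and z: "vec_supp z \<subseteq> vec_supp u" "\<And>i. z $ i * u $ i \<ge> 0"
  shows "conforming J X E z"
proof -
  have z0: "u $ i = 0 \<Longrightarrow> z $ i = 0" for i using z(1) by (auto simp: vec_supp_def)
  have le: "z $ i \<le> 0" if "u $ i \<le> 0" for i
    using z(2)[of i] z0[of i] that by (auto simp: zero_le_mult_iff)
  have ge: "z $ i \<ge> 0" if "u $ i \<ge> 0" for i
    using z(2)[of i] z0[of i] that by (auto simp: zero_le_mult_iff)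
  show ?thesis using u le ge z0 unfolding conforming_def by blast
qed

text \<open>Conformal decomposition: a dependency that is not a circuit is a positive combination of
  two dependencies with smaller supports and compatible signs, and one of them is again negative on
  \<open>w\<close>.\<close>

lemma conforming_circuit:
  assumes "config_proj a u = 0" "conforming J X E u" "u \<bullet> w < 0"
  shows "\<exists>c. circuit a c \<and> conforming J X E c \<and> c \<bullet> w < 0"
  using assms
proof (induction "card (vec_supp u)" arbitrary: u rule: less_induct)
  case less
  have u0: "u \<noteq> 0" using less.prems by auto
  have IH: "\<exists>c. circuit a c \<and> conforming J X E c \<and> c \<bullet> w < 0"
    if "vec_supp z \<subset> vec_supp u" "config_proj a z = 0" "\<And>i. z $ i * u $ i \<ge> 0" "z \<bullet> w < 0" for z
    using that less.prems by (intro less.hyps[of z] psubset_card_mono conforming_mono[of J X E u z]) auto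
  show ?case
  proof (cases "circuit a u")
    case True
    then show ?thesis using less.prems by blast
  next
    case False
    then obtain z where z: "config_proj a z = 0" "z \<noteq> 0" "vec_supp z \<subset> vec_supp u"
      using less.prems u0 unfolding circuit_def by blast
    then obtain k where k: "z $ k \<noteq> 0" by (auto simp: vec_eq_iff)
    then have "u $ k \<noteq> 0" using z(3) by (auto simp: vec_supp_def)
    \<comment> \<open>The sign is chosen to agree with \<open>u\<close> at \<open>k\<close>, so that
      a positive multiple can be subtracted.\<close>
    define z' where "z' = (if z $ k * u $ k > 0 then z else - z)"
    have z': "config_proj a z' = 0" "vec_supp z' \<subset> vec_supp u" "z' $ k * u $ k > 0"
      using z k \<open>u $ k \<noteq> 0\<close> by (auto simp: z'_def config_proj_minus vec_supp_def zero_less_mult_iff mult_less_0_iff)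
    obtain r where r: "r > 0" "vec_supp (u - r *\<^sub>R z') \<subset> vec_supp u" "\<And>i. (u - r *\<^sub>R z') $ i * u $ i \<ge> 0"
      using vec_supp_reduce[OF psubset_imp_subset[OF z'(2)] z'(3)] by blast
    define y where "y = u - r *\<^sub>R z'"
    have y: "config_proj a y = 0" "vec_supp y \<subset> vec_supp u" "\<And>i. y $ i * u $ i \<ge> 0"
      using less.prems z' r by (auto simp: y_def config_proj_diff config_proj_scaleR)
    \<comment> \<open>At \<open>j\<close> the vector \<open>y\<close> coincides with
      \<open>u\<close>, so \<open>y\<close> can in turn be subtracted from \<open>u\<close>. Thus
      \<open>u\<close> splits as \<open>s *\<^sub>R y\<close> plus the remainder.\<close>
    obtain j where j: "j \<in> vec_supp u" "j \<notin> vec_supp z'" using z'(2) by blast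
    then have "y $ j * u $ j > 0"
      by (auto simp: y_def vec_supp_def zero_less_mult_iff)
    then obtain s where s: "s > 0" "vec_supp (u - s *\<^sub>R y) \<subset> vec_supp u" "\<And>i. (u - s *\<^sub>R y) $ i * u $ i \<ge> 0"
      using vec_supp_reduce[OF psubset_imp_subset[OF y(2)]] by blast
    have "s * (y \<bullet> w) + (u - s *\<^sub>R y) \<bullet> w < 0" using less.prems by (simp add: inner_diff_left)
    then have "y \<bullet> w < 0 \<or> (u - s *\<^sub>R y) \<bullet> w < 0"
      using s(1) by (smt (verit) mult_nonneg_nonneg)
    then show ?thesis
    proof
      assume "y \<bullet> w < 0"
      then show ?thesis by (intro IH[OF y(2,1,3)])
    next
      assume "(u - s *\<^sub>R y) \<bullet> w < 0"
      then show ?thesis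
        using y(1) less.prems s by (intro IH) (auto simp: config_proj_diff config_proj_scaleR)
    qed
  qed
qed

section \<open>Circuits: uniqueness up to scaling and size\<close>

lemma circuitD: "circuit a u \<Longrightarrow> config_proj a u = 0" "circuit a u \<Longrightarrow> u \<noteq> 0"
  by (simp_all add: circuit_def)

lemma circuit_minimal:
  assumes "circuit a u" "config_proj a z = 0" "vec_supp z \<subset> vec_supp u"
  shows "z = 0"
proof (rule ccontr)
  assume "z \<noteq> 0"
  with assms have "vec_supp z = vec_supp u" unfolding circuit_def by (simp add: psubset_imp_subset)
  with assms(3) show False by simp
qed

text \<open>The combination that cancels one coordinate has smaller support, hence vanishes by
  minimality.\<close>

lemma circuit_proportional:
  assumes "circuit a u" "circuit a z" "vec_supp z = vec_supp u"
  obtains r where "r \<noteq> 0" "z = r *\<^sub>R u"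
proof -
  obtain k where k: "u $ k \<noteq> 0" using circuitD(2)[OF assms(1)] by (auto simp: vec_eq_iff)
  have z0: "z $ i = 0 \<longleftrightarrow> u $ i = 0" for i
    using assms(3) unfolding vec_supp_def by blast
  then have zk: "z $ k \<noteq> 0" using k by blast
  define r where "r = z $ k / u $ k"
  have "config_proj a (z - r *\<^sub>R u) = 0"
    by (simp add: circuitD(1)[OF assms(1)] circuitD(1)[OF assms(2)] config_proj_diff config_proj_scaleR)
  moreover have "vec_supp (z - r *\<^sub>R u) \<subseteq> vec_supp u"
    using z0 by (auto simp: vec_supp_def)
  moreover have "k \<in> vec_supp u" "k \<notin> vec_supp (z - r *\<^sub>R u)"
    using k by (auto simp: r_def vec_supp_def)
  ultimately have "z - r *\<^sub>R u = 0"
    using circuit_minimal[OF assms(1), of "z - r *\<^sub>R u"] by (metis psubsetI)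
  then have "z = r *\<^sub>R u" by simp
  moreover have "r \<noteq> 0" using k zk by (simp add: r_def)
  ultimately show ?thesis using that by blast
qed

lemma circuit_minus: "circuit a u \<Longrightarrow> circuit a (- u)"
  unfolding circuit_def by (simp add: config_proj_minus vec_supp_def)

text \<open>One circuit for each of the finitely many supports, together with its negative, suffices
  up to positive scaling. This makes the search for the first violated circuit a finite
  minimization.\<close>

lemma finite_circuit_representatives:
  obtains R where "finite R" "\<And>r. r \<in> R \<Longrightarrow> circuit a r"
    "\<And>u. circuit a u \<Longrightarrow> \<exists>r\<in>R. \<exists>t>0. u = t *\<^sub>R r"
proof -
  define rep where "rep S = (SOME u. circuit a u \<and> vec_supp u = S)" for S
  have rep: "circuit a (rep (vec_supp u)) \<and> vec_supp (rep (vec_supp u)) = vec_supp u" if "circuit a u" for u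
    unfolding rep_def by (rule someI[of _ u]) (use that in simp)
  define R0 where "R0 = rep ` {vec_supp u | u. circuit a u}"
  have R0: "finite R0" "\<And>r. r \<in> R0 \<Longrightarrow> circuit a r"
    using rep by (auto simp: R0_def)
  show ?thesis
  proof (rule that[of "R0 \<union> uminus ` R0"])
    show "finite (R0 \<union> uminus ` R0)" using R0 by simp
    show "circuit a r" if "r \<in> R0 \<union> uminus ` R0" for r
      using that R0(2) circuit_minus by auto
    show "\<exists>r\<in>R0 \<union> uminus ` R0. \<exists>t>0. u = t *\<^sub>R r" if u: "circuit a u" for u
    proof -
      obtain t where t: "t \<noteq> 0" "u = t *\<^sub>R rep (vec_supp u)"
        using circuit_proportional[of a "rep (vec_supp u)" u] rep[OF u] u by metis
      have R: "rep (vec_supp u) \<in> R0" using u by (auto simp: R0_def)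
      show ?thesis
      proof (cases "t > 0")
        case True
        then show ?thesis using t R by blast
      next
        case False
        then have "- t > 0" "u = (- t) *\<^sub>R (- rep (vec_supp u))" using t by auto
        then show ?thesis using R by blast
      qed
    qed
  qed
qed

text \<open>The vectors \<open>(a i, 1)\<close> live in dimension \<open>d + 1\<close>. Injectivity
  turns a linear relation on the set of vectors into one indexed by \<open>I\<close>.\<close>

lemma exists_dependency:
  fixes a :: "'n::finite \<Rightarrow> real^'d"
  assumes "inj a" "CARD('d) + 2 \<le> card I"
  obtains z where "config_proj a z = 0" "z \<noteq> 0" "vec_supp z \<subseteq> I"
proof -
  define b where "b i = (a i, 1::real)" for i
  have b: "inj_on b I" using assms(1) by (auto simp: b_def inj_on_def)
  have "card (b ` I) = card I" by (rule card_image[OF b])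
  then have "dependent (b ` I)"
    using assms(2) independent_bound[of "b ` I"] by fastforce
  then obtain f where f: "\<exists>v\<in>b ` I. f v \<noteq> 0" "(\<Sum>v\<in>b ` I. f v *\<^sub>R v) = 0"
    using dependent_finite[of "b ` I"] by auto
  define z :: "real^'n" where "z = (\<chi> i. if i \<in> I then f (b i) else 0)"
  have "config_proj a z = (\<Sum>i\<in>UNIV. if i \<in> I then f (b i) *\<^sub>R b i else 0)"
    unfolding config_proj_def z_def b_def by (intro sum.cong refl) (auto simp: zero_prod_def)
  also have "\<dots> = (\<Sum>i\<in>I. f (b i) *\<^sub>R b i)" by (simp add: sum.If_cases)
  also have "\<dots> = 0" using f(2) by (simp add: sum.reindex[OF b])
  finally have "config_proj a z = 0" .
  moreover have "z \<noteq> 0" using f(1) by (auto simp: z_def vec_eq_iff)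
  moreover have "vec_supp z \<subseteq> I" by (auto simp: z_def vec_supp_def)
  ultimately show ?thesis using that by blast
qed

lemma card_circuit_le:
  fixes a :: "'n::finite \<Rightarrow> real^'d"
  assumes "inj a" "circuit a u"
  shows "card (vec_supp u) \<le> CARD('d) + 2"
proof (rule ccontr)
  assume large: "\<not> ?thesis"
  then obtain I where I: "I \<subseteq> vec_supp u" "card I = CARD('d) + 2"
    using obtain_subset_with_card_n[of "CARD('d) + 2" "vec_supp u"] by auto
  then obtain z where "config_proj a z = 0" "z \<noteq> 0" "vec_supp z \<subseteq> I"
    using exists_dependency[OF assms(1), of I] by auto
  moreover have "vec_supp z \<noteq> vec_supp u"
    using calculation(3) I card_mono[of I "vec_supp z"] large by auto
  ultimately show False using circuit_minimal[OF assms(2), of z] I(1) by blast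
qed

section \<open>Cells of the coherent subdivisions of hypersimplices\<close>

definition level :: "'n::finite set \<Rightarrow> nat \<Rightarrow> 'n set \<Rightarrow> 'n set \<Rightarrow> bool" where
  "level J k X E \<longleftrightarrow> X \<inter> E = {} \<and> X \<union> E \<subseteq> J \<and>
     (card X < k \<and> k < card X + card E \<or> E = {} \<and> card X = k)"

lemma subspace_coord_subspace: "subspace (coord_subspace J)"
  by (auto simp: subspace_def coord_subspace_def)

lemma hypersimplex_eq_Int:
  "hypersimplex J k = cbox 0 (\<chi> i. if i \<in> J then 1 else 0) \<inter> {x. (\<chi> i. 1) \<bullet> x = real k}"
proof (rule set_eqI)
  fix x :: "real^'a"
  have box: "x \<in> cbox 0 (\<chi> i. if i \<in> J then 1 else 0) \<longleftrightarrow>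
      x \<in> coord_subspace J \<and> (\<forall>i\<in>J. 0 \<le> x $ i \<and> x $ i \<le> 1)"
    unfolding mem_box_cart coord_subspace_def by (auto intro: order_antisym)
  have "(\<Sum>i\<in>UNIV. x $ i) = (\<Sum>i\<in>J. x $ i)" if "x \<in> coord_subspace J"
    by (rule sum.mono_neutral_right) (use that in \<open>auto simp: coord_subspace_def\<close>)
  then show "x \<in> hypersimplex J k \<longleftrightarrow>
      x \<in> cbox 0 (\<chi> i. if i \<in> J then 1 else 0) \<inter> {x. (\<chi> i. 1) \<bullet> x = real k}"
    unfolding Int_iff box by (auto simp: hypersimplex_def inner_vec_def)
qed

lemma polytope_hypersimplex: "polytope (hypersimplex J k)"
  unfolding hypersimplex_eq_Int
  by (intro polytope_Int_polyhedron polytope_interval polyhedron_hyperplane)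

text \<open>The orthogonal projection to \<open>coord_subspace J\<close>. It lets one weight in the
  full space be tested against fans living in different coordinate subspaces.\<close>

definition restrict_coords :: "'n::finite set \<Rightarrow> real^'n \<Rightarrow> real^'n" where
  "restrict_coords J w = (\<chi> i. if i \<in> J then w $ i else 0)"

lemma restrict_coords_in: "restrict_coords J w \<in> coord_subspace J"
  by (simp add: restrict_coords_def coord_subspace_def)

lemma inner_restrict_coords:
  assumes "x \<in> coord_subspace J"
  shows "restrict_coords J w \<bullet> x = w \<bullet> x"
  unfolding inner_vec_def restrict_coords_def
  using assms by (intro sum.cong) (auto simp: coord_subspace_def)

lemma min_face_restrict_coords:
  assumes "P \<subseteq> coord_subspace J"
  shows "min_face P (restrict_coords J w) = min_face P w"
proof (rule min_face_cong)
  fix x y assume "x \<in> P" "y \<in> P"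
  then have "x \<in> coord_subspace J" "y \<in> coord_subspace J" using assms by auto
  then show "restrict_coords J w \<bullet> (x - y) = w \<bullet> (x - y)"
    by (simp add: inner_restrict_coords inner_diff_right)
qed

lemma supported_restrict_coords:
  assumes "X \<union> E \<subseteq> J"
  shows "supported a J X E (restrict_coords J w) \<longleftrightarrow> supported a J X E w"
proof -
  have "restrict_coords J w $ i = w $ i" if "i \<in> J" for i
    using that by (simp add: restrict_coords_def)
  moreover have "i \<in> J" if "i \<in> X" for i using that assms by auto
  moreover have "i \<in> J" if "i \<in> E" for i using that assms by auto
  ultimately show ?thesis unfolding supported_def by simp
qed

lemma separating_threshold:
  fixes f :: "'i \<Rightarrow> real"
  assumes "finite A" "finite B" "\<And>i j. i \<in> A \<Longrightarrow> j \<in> B \<Longrightarrow> f i \<le> f j"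
  obtains t where "\<And>i. i \<in> A \<Longrightarrow> f i \<le> t" "\<And>j. j \<in> B \<Longrightarrow> t \<le> f j"
proof (cases "A = {}")
  case True
  \<comment> \<open>Without lower constraints the minimum over \<open>B\<close> works;
    \<open>0\<close> is an arbitrary value when both sets are empty.\<close>
  show ?thesis
    by (rule that[of "if B = {} then 0 else Min (f ` B)"]) (use True assms(2) in auto)
next
  case False
  show ?thesis
    by (rule that[of "Max (f ` A)"]) (use False assms in auto)
qed

text \<open>Exchange argument: moving a little mass from a positive coordinate \<open>i\<close> to a
  coordinate \<open>j\<close> below \<open>1\<close> stays in the hypersimplex, so minimality gives
  \<open>w $ i \<le> w $ j\<close>.\<close>

lemma min_face_hypersimplex_threshold:
  fixes a :: "'n::finite \<Rightarrow> real^'d"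
  assumes y: "y \<in> min_face (hypersimplex J k) w"
  shows "\<exists>t. (\<forall>i\<in>J. 0 < y $ i \<longrightarrow> w $ i \<le> t) \<and> (\<forall>i\<in>J. y $ i < 1 \<longrightarrow> t \<le> w $ i)"
proof -
  have yQ: "y \<in> hypersimplex J k" using min_faceD(1)[OF y] .
  have exch: "w $ i \<le> w $ j" if i: "i \<in> J" "0 < y $ i" and j: "j \<in> J" "y $ j < 1" for i j
  proof (cases "i = j")
    case False
    define e where "e = min (y $ i) (1 - y $ j)"
    have e: "0 < e" "e \<le> y $ i" "e \<le> 1 - y $ j" using i j by (auto simp: e_def)
    define z where "z = y + e *\<^sub>R (axis j 1 - axis i 1)"
    have zn: "z $ l = y $ l + (if l = j then e else 0) - (if l = i then e else 0)" for l
      by (auto simp: z_def axis_def)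
    have "(\<Sum>l\<in>J. z $ l) = (\<Sum>l\<in>J. y $ l)"
      using i j by (simp add: zn sum.distrib sum_subtractf)
    moreover have "0 \<le> z $ l \<and> z $ l \<le> 1" if "l \<in> J" for l
    proof -
      have "0 \<le> y $ l \<and> y $ l \<le> 1" using yQ that by (simp add: hypersimplex_def)
      then show ?thesis using e False by (auto simp: zn)
    qed
    ultimately have "z \<in> hypersimplex J k"
      using yQ i j by (auto simp: hypersimplex_def coord_subspace_def zn)
    from min_faceD(2)[OF y this] have "0 \<le> e * (w $ j - w $ i)"
      by (simp add: z_def inner_add_right inner_diff_right inner_axis)
    then show ?thesis using e(1) by (simp add: zero_le_mult_iff)
  qed auto
  obtain t where "\<And>i. i \<in> {i \<in> J. 0 < y $ i} \<Longrightarrow> w $ i \<le> t" "\<And>j. j \<in> {j \<in> J. y $ j < 1} \<Longrightarrow> t \<le> w $ j"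
    by (rule separating_threshold[of "{i \<in> J. 0 < y $ i}" "{j \<in> J. y $ j < 1}" "\<lambda>i. w $ i"])
      (use exch in auto)
  then show ?thesis by blast
qed

text \<open>With threshold \<open>0\<close>, each product \<open>w $ i * y $ i\<close> is already
  minimal over the unit interval.\<close>

lemma min_face_hypersimplexI:
  assumes y: "y \<in> hypersimplex J k" and w: "w \<in> coord_subspace J"
    and le: "\<And>i. i \<in> J \<Longrightarrow> 0 < y $ i \<Longrightarrow> w $ i \<le> 0" "\<And>i. i \<in> J \<Longrightarrow> y $ i < 1 \<Longrightarrow> 0 \<le> w $ i"
  shows "y \<in> min_face (hypersimplex J k) w"
proof -
  have "w \<bullet> y \<le> w \<bullet> z" if z: "z \<in> hypersimplex J k" for z
  proof -
    have "w $ i * y $ i \<le> w $ i * z $ i" for i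
    proof (cases "i \<in> J")
      case True
      then have zi: "0 \<le> z $ i" "z $ i \<le> 1" and yi: "0 \<le> y $ i" "y $ i \<le> 1"
        using y z by (auto simp: hypersimplex_def)
      consider "y $ i = 0" | "y $ i = 1" | "0 < y $ i" "y $ i < 1" using yi by linarith
      then show ?thesis
      proof cases
        case 1
        then show ?thesis using le(2)[OF True] zi by simp
      next
        case 2
        then show ?thesis using mult_left_mono_neg[OF zi(2), of "w $ i"] le(1)[OF True] by simp
      next
        case 3
        then have "w $ i = 0" using le[OF True] by simp
        then show ?thesis by simp
      qed
    next
      case False
      then show ?thesis using w by (simp add: coord_subspace_def)
    qed
    then show ?thesis by (simp add: inner_vec_def sum_mono)
  qed
  then show ?thesis using y by (simp add: min_face_def)
qed

text \<open>Functionals on the coordinate subspace that agree on the kernel differ by an affine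
  function. The threshold of the hypersimplex is absorbed into its constant term.\<close>

lemma min_face_iff_supported:
  fixes a :: "'n::finite \<Rightarrow> real^'d"
  assumes y: "y \<in> hypersimplex J k"
  shows "(\<exists>w'\<in>coord_subspace J. (\<forall>x\<in>coord_subspace J. config_proj a x = 0 \<longrightarrow> w' \<bullet> x = w \<bullet> x) \<and>
       y \<in> min_face (hypersimplex J k) w') \<longleftrightarrow>
     supported a J {i \<in> J. y $ i = 1} {i \<in> J. 0 < y $ i \<and> y $ i < 1} w"
    (is "?L \<longleftrightarrow> supported a J ?X ?E w")
proof
  have bounds: "0 \<le> y $ i" "y $ i \<le> 1" if "i \<in> J" for i
    using y that by (auto simp: hypersimplex_def)
  {
    assume ?L
    then obtain w' where w': "w' \<in> coord_subspace J"
      "\<And>x. x \<in> coord_subspace J \<Longrightarrow> config_proj a x = 0 \<Longrightarrow> w' \<bullet> x = w \<bullet> x"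
      "y \<in> min_face (hypersimplex J k) w'" by blast
    \<comment> \<open>With everything in \<open>E\<close>, being supported means being affine on
      \<open>J\<close>; otherwise Farkas yields a kernel vector on which the two functionals
      differ.\<close>
    have "supported a J {} J (w - w')"
    proof (rule ccontr)
      assume "\<not> supported a J {} J (w - w')"
      then obtain u where u: "config_proj a u = 0" "conforming J {} J u" "u \<bullet> (w - w') < 0"
        by (rule supported_farkas[rotated 2]) auto
      then have "u \<in> coord_subspace J" by (auto simp: conforming_def coord_subspace_def)
      from w'(2)[OF this u(1)] u(3) show False
        by (simp add: inner_diff_right inner_commute[of u])
    qed
    then obtain c where c: "\<And>i. i \<in> J \<Longrightarrow> w $ i - w' $ i = aff_vec a c $ i"
      unfolding supported_def by auto
    obtain t where t: "\<And>i. i \<in> J \<Longrightarrow> 0 < y $ i \<Longrightarrow> w' $ i \<le> t" "\<And>i. i \<in> J \<Longrightarrow> y $ i < 1 \<Longrightarrow> t \<le> w' $ i"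
      using min_face_hypersimplex_threshold[OF w'(3)] by blast
    have ct: "aff_vec a (c + (0, t)) $ i = aff_vec a c $ i + t" for i
      by (simp add: aff_vec_add) (simp add: aff_vec_def)
    show "supported a J ?X ?E w"
      unfolding supported_def
    proof (intro exI conjI ballI)
      fix i assume "i \<in> ?X"
      then show "w $ i \<le> aff_vec a (c + (0, t)) $ i" using t(1)[of i] c[of i] by (simp add: ct)
    next
      fix i assume "i \<in> ?E"
      then have "w' $ i = t" "w $ i - w' $ i = aff_vec a c $ i" using t c by (auto intro: order_antisym)
      then show "w $ i = aff_vec a (c + (0, t)) $ i" unfolding ct by linarith
    next
      fix i assume "i \<in> J - ?X - ?E"
      then have "i \<in> J" "y $ i < 1" using bounds[of i] by auto
      then show "aff_vec a (c + (0, t)) $ i \<le> w $ i" using t(2)[of i] c[of i] by (simp add: ct)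
    qed
  next
    assume "supported a J ?X ?E w"
    then obtain c where c: "\<And>i. i \<in> ?X \<Longrightarrow> w $ i \<le> aff_vec a c $ i" "\<And>i. i \<in> ?E \<Longrightarrow> w $ i = aff_vec a c $ i"
      "\<And>i. i \<in> J - ?X - ?E \<Longrightarrow> aff_vec a c $ i \<le> w $ i"
      unfolding supported_def by blast
    let ?w = "restrict_coords J (w - aff_vec a c)"
    have "?w \<bullet> x = w \<bullet> x" if "x \<in> coord_subspace J" "config_proj a x = 0" for x
      using that inner_aff_vec[of x a c]
      by (simp add: inner_restrict_coords inner_diff_left inner_commute[of "aff_vec a c"])
    moreover have "y \<in> min_face (hypersimplex J k) ?w"
    proof (rule min_face_hypersimplexI[OF y restrict_coords_in])
      fix i assume i: "i \<in> J" "0 < y $ i"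
      then have "i \<in> ?X \<or> i \<in> ?E" using bounds[of i] by auto
      then have "w $ i \<le> aff_vec a c $ i" using c(1)[of i] c(2)[of i] by argo
      then show "?w $ i \<le> 0" using i by (simp add: restrict_coords_def)
    next
      fix i assume i: "i \<in> J" "y $ i < 1"
      then have "i \<in> ?E \<or> i \<in> J - ?X - ?E" by auto
      then have "aff_vec a c $ i \<le> w $ i" using c(2)[of i] c(3)[of i] by argo
      then show "0 \<le> ?w $ i" using i by (simp add: restrict_coords_def)
    qed
    ultimately show ?L using restrict_coords_in by blast
  }
qed

text \<open>The fractional coordinates sum to \<open>k - card X\<close>, which lies strictly between
  \<open>0\<close> and \<open>card E\<close> unless \<open>E\<close> is empty.\<close>

lemma level_if_hypersimplex:
  assumes y: "y \<in> hypersimplex J k"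
  shows "level J k {i \<in> J. y $ i = 1} {i \<in> J. 0 < y $ i \<and> y $ i < 1}" (is "level J k ?X ?E")
proof -
  have b: "0 \<le> y $ i" "y $ i \<le> 1" if "i \<in> J" for i using y that by (auto simp: hypersimplex_def)
  have "real k = (\<Sum>i\<in>J. y $ i)" using y by (simp add: hypersimplex_def)
  also have "\<dots> = (\<Sum>i\<in>?X \<union> ?E. y $ i)"
    using b by (intro sum.mono_neutral_right) force+
  also have "\<dots> = (\<Sum>i\<in>?X. y $ i) + (\<Sum>i\<in>?E. y $ i)"
    by (intro sum.union_disjoint) auto
  finally have k: "real k = real (card ?X) + (\<Sum>i\<in>?E. y $ i)" by simp
  show ?thesis
  proof (cases "?E = {}")
    case True
    then have "card ?X = k" using k by (simp only: True sum.empty)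
    with True show ?thesis unfolding level_def by blast
  next
    case False
    have "0 < (\<Sum>i\<in>?E. y $ i)" using False by (intro sum_pos) auto
    moreover have "(\<Sum>i\<in>?E. y $ i) < (\<Sum>i\<in>?E. 1)" using False by (intro sum_strict_mono) auto
    ultimately have "card ?X < k" "k < card ?X + card ?E" using k by auto
    then show ?thesis unfolding level_def by auto
  qed
qed

text \<open>The remaining mass \<open>k - card X\<close> is spread evenly over \<open>E\<close>; the
  level inequalities put the share \<open>q\<close> strictly between \<open>0\<close> and
  \<open>1\<close>.\<close>

lemma hypersimplex_if_level:
  assumes "level J k X E"
  obtains y where "y \<in> hypersimplex J k" "X = {i \<in> J. y $ i = 1}" "E = {i \<in> J. 0 < y $ i \<and> y $ i < 1}"
proof -
  have XE: "X \<inter> E = {}" "X \<union> E \<subseteq> J" and k: "E \<noteq> {} \<Longrightarrow> card X < k" "E \<noteq> {} \<Longrightarrow> k < card X + card E"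
    "E = {} \<Longrightarrow> card X = k"
    using assms by (auto simp: level_def)
  define q where "q = (real k - real (card X)) / real (card E)"
  have q: "0 < q \<and> q < 1" if "E \<noteq> {}"
  proof -
    have "0 < card E" using that by (simp add: card_gt_0_iff)
    then show ?thesis using k that by (simp add: q_def field_simps)
  qed
  define y :: "real^'a" where "y = (\<chi> i. if i \<in> X then 1 else if i \<in> E then q else 0)"
  have yX: "y $ i = 1" if "i \<in> X" for i using that by (simp add: y_def)
  have yE: "y $ i = q" if "i \<in> E" for i using that XE by (auto simp: y_def)
  have y0: "y $ i = 0" if "i \<notin> X \<union> E" for i using that by (simp add: y_def)
  have "(\<Sum>i\<in>J. y $ i) = (\<Sum>i\<in>X \<union> E. y $ i)"
    using XE y0 by (intro sum.mono_neutral_right) auto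
  also have "\<dots> = (\<Sum>i\<in>X. y $ i) + (\<Sum>i\<in>E. y $ i)"
    using XE by (intro sum.union_disjoint) auto
  also have "\<dots> = card X + card E * q" by (simp add: yX yE)
  also have "\<dots> = k" using k by (cases "E = {}") (auto simp: q_def)
  finally have sum: "(\<Sum>i\<in>J. y $ i) = k" .
  have "0 \<le> y $ i \<and> y $ i \<le> 1" for i
    using q by (cases "i \<in> X"; cases "i \<in> E") (force simp: y_def)+
  moreover have "y \<in> coord_subspace J" using XE y0 by (auto simp: coord_subspace_def)
  ultimately have "y \<in> hypersimplex J k" using sum by (simp add: hypersimplex_def)
  moreover have "X = {i \<in> J. y $ i = 1}" "E = {i \<in> J. 0 < y $ i \<and> y $ i < 1}"
    using XE q by (auto simp: y_def split: if_splits)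
  ultimately show ?thesis using that by blast
qed

text \<open>The bridge from fiber polytopes to combinatorics: all later arguments about
  \<open>P\<close> and the \<open>F J\<close> compare supported pairs, for arbitrary weights of the
  full space.\<close>

lemma hypersecondary_min_face_iff:
  fixes a :: "'n::finite \<Rightarrow> real^'d"
  assumes P: "is_hypersecondary_polytope a J k P"
  shows "min_face P w = min_face P v \<longleftrightarrow>
    (\<forall>X E. level J k X E \<longrightarrow> (supported a J X E w \<longleftrightarrow> supported a J X E v))"
proof -
  let ?V = "coord_subspace J" and ?Q = "hypersimplex J k"
  let ?X = "\<lambda>y. {i \<in> J. y $ i = 1}" and ?E = "\<lambda>y. {i \<in> J. 0 < y $ i \<and> y $ i < 1}"
  have fib: "is_fiber_polytope ?V (config_proj a) ?Q P"
    using P by (simp add: is_hypersecondary_polytope_def)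
  then have PV: "P \<subseteq> ?V" by (simp add: is_fiber_polytope_def)
  note in_V = restrict_coords_in[of J w] restrict_coords_in[of J v]
  have sup: "supported a J (?X y) (?E y) (restrict_coords J u) \<longleftrightarrow> supported a J (?X y) (?E y) u" for y u
    by (intro supported_restrict_coords) auto
  have "min_face P w = min_face P v \<longleftrightarrow>
      min_face P (restrict_coords J w) = min_face P (restrict_coords J v)"
    by (simp only: min_face_restrict_coords[OF PV])
  also have "\<dots> \<longleftrightarrow> coherent_subdivision ?V (config_proj a) ?Q (restrict_coords J w) =
      coherent_subdivision ?V (config_proj a) ?Q (restrict_coords J v)"
    by (rule fiber_polytope_min_face_iff[OF fib subspace_coord_subspace in_V])
  also have "\<dots> \<longleftrightarrow> (\<forall>y\<in>?Q. supported a J (?X y) (?E y) w \<longleftrightarrow> supported a J (?X y) (?E y) v)"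
    unfolding coherent_subdivision_eq_iff[OF polytope_hypersimplex subspace_coord_subspace in_V]
    by (intro ball_cong refl) (simp only: min_face_iff_supported sup)
  also have "\<dots> \<longleftrightarrow> (\<forall>X E. level J k X E \<longrightarrow> (supported a J X E w \<longleftrightarrow> supported a J X E v))"
  proof
    assume *: "\<forall>y\<in>?Q. supported a J (?X y) (?E y) w \<longleftrightarrow> supported a J (?X y) (?E y) v"
    show "\<forall>X E. level J k X E \<longrightarrow> (supported a J X E w \<longleftrightarrow> supported a J X E v)"
    proof (intro allI impI)
      fix X E assume "level J k X E"
      then obtain y where y: "y \<in> ?Q" "X = ?X y" "E = ?E y" by (rule hypersimplex_if_level)
      show "supported a J X E w \<longleftrightarrow> supported a J X E v"
        unfolding y(2,3) by (rule bspec[OF * y(1)])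
    qed
  next
    assume "\<forall>X E. level J k X E \<longrightarrow> (supported a J X E w \<longleftrightarrow> supported a J X E v)"
    then show "\<forall>y\<in>?Q. supported a J (?X y) (?E y) w \<longleftrightarrow> supported a J (?X y) (?E y) v"
      using level_if_hypersimplex by blast
  qed
  finally show ?thesis .
qed

section \<open>Leaving the cone of weights that support a pair\<close>

lemma config_proj_sum_zero:
  assumes "config_proj a u = 0"
  shows "(\<Sum>i\<in>UNIV. u $ i) = 0"
  using inner_aff_vec[of u a "(0, 1)"] assms by (simp add: inner_vec_def aff_vec_def)

text \<open>Subtracting the affine function leaves \<open>u \<bullet> w\<close> unchanged and makes
  every summand nonnegative, so a zero sum forces equality on the support.\<close>

lemma conforming_inner:
  assumes conf: "conforming J X E u" and u: "config_proj a u = 0"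
    and X: "\<And>i. i \<in> X \<Longrightarrow> w $ i \<le> aff_vec a c $ i" and E: "\<And>i. i \<in> E \<Longrightarrow> w $ i = aff_vec a c $ i"
    and Z: "\<And>i. i \<in> J - X - E \<Longrightarrow> aff_vec a c $ i \<le> w $ i"
  shows "0 \<le> u \<bullet> w" "u \<bullet> w = 0 \<Longrightarrow> i \<in> vec_supp u \<Longrightarrow> w $ i = aff_vec a c $ i"
proof -
  have nonneg: "0 \<le> u $ i * (w $ i - aff_vec a c $ i)" for i
  proof -
    consider "i \<notin> J" "i \<notin> X" | "i \<in> X" | "i \<in> E" | "i \<in> J - X - E" by blast
    then show ?thesis
    proof cases
      case 1
      then show ?thesis using conf by (simp add: conforming_def)
    next
      case 2
      then show ?thesis using conf X[of i] by (simp add: conforming_def mult_nonpos_nonpos)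
    next
      case 3
      then show ?thesis using E[of i] by simp
    next
      case 4
      then show ?thesis using conf Z[of i] by (simp add: conforming_def)
    qed
  qed
  have sum: "u \<bullet> w = (\<Sum>i\<in>UNIV. u $ i * (w $ i - aff_vec a c $ i))"
  proof -
    have "u \<bullet> w = u \<bullet> (w - aff_vec a c)" by (simp add: inner_diff_right inner_aff_vec u)
    then show ?thesis by (simp add: inner_vec_def)
  qed
  show "0 \<le> u \<bullet> w" unfolding sum by (intro sum_nonneg nonneg)
  show "w $ i = aff_vec a c $ i" if "u \<bullet> w = 0" "i \<in> vec_supp u"
  proof -
    have "\<forall>i\<in>UNIV. u $ i * (w $ i - aff_vec a c $ i) = 0"
      using that(1) nonneg unfolding sum by (subst (asm) sum_nonneg_eq_0_iff) auto
    then have "u $ i * (w $ i - aff_vec a c $ i) = 0" by blast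
    then show ?thesis using that(2) by (simp add: vec_supp_def)
  qed
qed

lemma conforming_inner_nonneg:
  assumes "conforming J X E u" "config_proj a u = 0" "supported a J X E w"
  shows "0 \<le> u \<bullet> w"
proof -
  obtain c where "\<And>i. i \<in> X \<Longrightarrow> w $ i \<le> aff_vec a c $ i" "\<And>i. i \<in> E \<Longrightarrow> w $ i = aff_vec a c $ i"
    "\<And>i. i \<in> J - X - E \<Longrightarrow> aff_vec a c $ i \<le> w $ i"
    using assms(3) unfolding supported_def by blast
  from conforming_inner(1)[OF assms(1,2) this] show ?thesis by blast
qed

lemma vec_supp_inner_zero:
  assumes "config_proj a u = 0" "\<And>i. i \<in> vec_supp u \<Longrightarrow> v $ i = aff_vec a c $ i"
  shows "u \<bullet> v = 0"
proof -
  have "u \<bullet> v = u \<bullet> aff_vec a c"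
    unfolding inner_vec_def using assms(2) by (intro sum.cong) (auto simp: vec_supp_def)
  then show ?thesis by (simp add: inner_aff_vec assms(1))
qed

text \<open>
  The parameter \<open>t\<close> is the last one for which the pair is supported on the segment from \<open>w\<close> to \<open>v\<close>;
  there some conforming circuit changes sign.
\<close>
lemma supported_first_exit:
  assumes XE: "X \<inter> E = {}" "X \<union> E \<subseteq> J"
    and w: "supported a J X E w" and v: "\<not> supported a J X E v"
  obtains t u where "0 \<le> t" "t \<le> 1" "circuit a u" "conforming J X E u" "u \<bullet> v < 0"
    "supported a J X E ((1 - t) *\<^sub>R w + t *\<^sub>R v)" "u \<bullet> ((1 - t) *\<^sub>R w + t *\<^sub>R v) = 0"
proof -
  obtain R where R: "finite R" "\<And>r. r \<in> R \<Longrightarrow> circuit a r"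
    "\<And>u. circuit a u \<Longrightarrow> \<exists>r\<in>R. \<exists>t>0. u = t *\<^sub>R r"
    using finite_circuit_representatives[of a] by blast
  define B where "B z = {r \<in> R. conforming J X E r \<and> r \<bullet> z < 0}" for z
  have B_ne: "B z \<noteq> {}" if z: "\<not> supported a J X E z" for z
  proof -
    obtain u where u: "config_proj a u = 0" "conforming J X E u" "u \<bullet> z < 0"
      by (rule supported_farkas[OF XE z])
    from conforming_circuit[OF this]
    obtain c where c: "circuit a c" "conforming J X E c" "c \<bullet> z < 0" by blast
    from R(3)[OF c(1)] obtain r t where r: "r \<in> R" "t > 0" "c = t *\<^sub>R r" by blast
    have "conforming J X E r" using c(2) r(2) unfolding r(3)
      by (auto simp: conforming_def mult_le_0_iff zero_le_mult_iff)
    moreover have "r \<bullet> z < 0" using c(3) r(2) unfolding r(3) by (simp add: mult_less_0_iff)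
    ultimately have "r \<in> B z" using r(1) by (simp add: B_def)
    then show ?thesis by blast
  qed
  have w_nonneg: "0 \<le> r \<bullet> w" if "r \<in> R" "conforming J X E r" for r
    using conforming_inner_nonneg[OF that(2) circuitD(1)[OF R(2)[OF that(1)]] w] .
  \<comment> \<open>The parameter at which \<open>r\<close> vanishes on the segment from
    \<open>w\<close> to \<open>v\<close>; the circuit with the least such value is violated
    first.\<close>
  define f where "f r = (r \<bullet> w) / (r \<bullet> w - r \<bullet> v)" for r
  have "finite (B v)" using R(1) by (simp add: B_def)
  then obtain u where u: "u \<in> B v" "\<And>r. r \<in> B v \<Longrightarrow> f u \<le> f r"
    using B_ne[OF v] ex_is_arg_min_if_finite[of "B v" f]
    by (auto simp: is_arg_min_linorder)
  define t where "t = f u"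
  let ?z = "(1 - t) *\<^sub>R w + t *\<^sub>R v"
  have uR: "u \<in> R" "conforming J X E u" "u \<bullet> v < 0" using u(1) by (auto simp: B_def)
  have uw: "0 \<le> u \<bullet> w" using w_nonneg uR by blast
  have t: "0 \<le> t" "t \<le> 1" using uw uR(3) by (auto simp: t_def f_def field_simps)
  have inner_z: "r \<bullet> ?z = r \<bullet> w - t * (r \<bullet> w - r \<bullet> v)" for r
    by (simp add: inner_add_right algebra_simps)
  have "r \<bullet> ?z \<ge> 0" if r: "r \<in> R" "conforming J X E r" for r
  proof (cases "r \<bullet> v < 0")
    case True
    then have "t \<le> f r" using u(2) r by (simp add: t_def B_def)
    moreover have "r \<bullet> w - r \<bullet> v > 0" using True w_nonneg[OF r] by linarith
    ultimately show ?thesis unfolding inner_z f_def by (simp add: field_simps)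
  next
    case False
    then have "0 \<le> (1 - t) * (r \<bullet> w) + t * (r \<bullet> v)" using t w_nonneg[OF r] by simp
    then show ?thesis by (simp add: inner_add_right)
  qed
  then have "B ?z = {}" by (force simp: B_def)
  then have "supported a J X E ?z" using B_ne by blast
  moreover have "u \<bullet> ?z = 0"
  proof -
    have "t * (u \<bullet> w - u \<bullet> v) = u \<bullet> w" using uw uR(3) by (simp add: t_def f_def)
    then show ?thesis unfolding inner_z by simp
  qed
  ultimately show ?thesis using that t R(2)[OF uR(1)] uR by blast
qed

text \<open>
  If \<open>card X = k\<close>, then the negative coordinates of the circuit lie in \<open>X\<close>, so equality holds somewhere
  on \<open>X\<close>; this makes the last inequality strict.
\<close>
lemma level_wall:
  assumes lev: "level J k X E" and w: "supported a J X E w" and v: "\<not> supported a J X E v"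
  obtains t u c where "0 \<le> t" "t \<le> 1" "circuit a u" "vec_supp u \<subseteq> J" "u \<bullet> v < 0"
    "\<And>i. i \<in> vec_supp u \<Longrightarrow> ((1 - t) *\<^sub>R w + t *\<^sub>R v) $ i = aff_vec a c $ i"
    "card {i \<in> J. ((1 - t) *\<^sub>R w + t *\<^sub>R v) $ i < aff_vec a c $ i} < k"
proof -
  have XE: "X \<inter> E = {}" "X \<union> E \<subseteq> J" using lev by (auto simp: level_def)
  obtain t u where t: "0 \<le> t" "t \<le> 1" and u: "circuit a u" "conforming J X E u" "u \<bullet> v < 0"
    and z: "supported a J X E ((1 - t) *\<^sub>R w + t *\<^sub>R v)" "u \<bullet> ((1 - t) *\<^sub>R w + t *\<^sub>R v) = 0"
    by (rule supported_first_exit[OF XE w v])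
  define z where "z = (1 - t) *\<^sub>R w + t *\<^sub>R v"
  obtain c where c: "\<And>i. i \<in> X \<Longrightarrow> z $ i \<le> aff_vec a c $ i" "\<And>i. i \<in> E \<Longrightarrow> z $ i = aff_vec a c $ i"
    "\<And>i. i \<in> J - X - E \<Longrightarrow> aff_vec a c $ i \<le> z $ i"
    using z(1) unfolding z_def[symmetric] supported_def by blast
  have eq: "z $ i = aff_vec a c $ i" if "i \<in> vec_supp u" for i
    using conforming_inner(2)[OF u(2) circuitD(1)[OF u(1)] c _ that] z(2)[folded z_def] by blast
  let ?L = "{i \<in> J. z $ i < aff_vec a c $ i}"
  have LX: "?L \<subseteq> X"
  proof
    fix i assume i: "i \<in> ?L"
    then have "i \<notin> E" "i \<notin> J - X - E" using c(2,3)[of i] by (auto simp: not_less)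
    then show "i \<in> X" using i by blast
  qed
  have "card ?L < k"
  proof (cases "card X < k")
    case True
    then show ?thesis using card_mono[OF _ LX] by simp
  next
    case False
    then have X: "E = {}" "card X = k" using lev by (auto simp: level_def)
    have "\<exists>i. u $ i < 0"
    proof (rule ccontr)
      assume "\<not> (\<exists>i. u $ i < 0)"
      then have "\<forall>i\<in>UNIV. u $ i = 0"
        using config_proj_sum_zero[OF circuitD(1)[OF u(1)]]
        by (subst (asm) sum_nonneg_eq_0_iff) (auto simp: not_less)
      then show False using circuitD(2)[OF u(1)] by (simp add: vec_eq_iff)
    qed
    then obtain i where i: "u $ i < 0" by blast
    then have "i \<in> X" using u(2) X(1) unfolding conforming_def by (metis DiffI empty_iff less_irrefl not_less)
    moreover have "i \<notin> ?L" using eq[of i] i by (simp add: vec_supp_def)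
    ultimately have "?L \<subset> X" using LX by blast
    then show ?thesis using psubset_card_mono[of X ?L] X(2) by simp
  qed
  moreover have "vec_supp u \<subseteq> J" using u(2) by (auto simp: conforming_def vec_supp_def)
  ultimately show ?thesis using that[of t u c] t u(1,3) eq by (simp add: z_def)
qed

text \<open>Dropping one point \<open>j\<close> of the support leaves at most \<open>d\<close>
  points, so some nonzero affine function vanishes on them, and the dependency extends this to
  \<open>j\<close>. As the points affinely span, it is nonzero somewhere; its sign can be
  flipped.\<close>

lemma exists_affine_vanishing:
  fixes a :: "'n::finite \<Rightarrow> real^'d"
  assumes aff: "affine hull (range a) = UNIV" and u: "config_proj a u = 0" "u \<noteq> 0" "vec_supp u \<subseteq> I"
    and I: "card I \<le> CARD('d) + 1"
  obtains c k where "\<And>i. i \<in> I \<Longrightarrow> aff_vec a c $ i = 0" "aff_vec a c $ k > 0"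
proof -
  obtain j where j: "u $ j \<noteq> 0" using u(2) by (auto simp: vec_eq_iff)
  then have jI: "j \<in> I" using u(3) by (auto simp: vec_supp_def)
  let ?b = "\<lambda>i. (a i, 1::real)"
  have "dim (?b ` (I - {j})) \<le> card (?b ` (I - {j}))"
    by (intro dim_le_card span_superset) simp
  also have "\<dots> \<le> card (I - {j})" by (rule card_image_le) simp
  also have "\<dots> < CARD('d) + 1" using I jI by (simp add: card_gt_0_iff less_eq_Suc_le[symmetric])
  finally have "dim (?b ` (I - {j})) < DIM((real^'d) \<times> real)" by simp
  then obtain c where c: "c \<noteq> 0" "\<And>y. y \<in> span (?b ` (I - {j})) \<Longrightarrow> orthogonal c y"
    using orthogonal_to_subspace_exists by blast
  have zero: "aff_vec a c $ i = 0" if "i \<in> I - {j}" for i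
    using c(2)[of "?b i"] that by (auto simp: orthogonal_def aff_vec_def intro: span_base)
  have "u \<bullet> aff_vec a c = (\<Sum>i\<in>UNIV. u $ i * aff_vec a c $ i)" by (simp add: inner_vec_def)
  also have "\<dots> = (\<Sum>i\<in>{j}. u $ i * aff_vec a c $ i)"
  proof (rule sum.mono_neutral_right)
    show "\<forall>i\<in>UNIV - {j}. u $ i * aff_vec a c $ i = 0"
      using zero u(3) by (auto simp: vec_supp_def)
  qed auto
  finally have "aff_vec a c $ j = 0" using j by (simp add: inner_aff_vec u(1))
  with zero have zero: "aff_vec a c $ i = 0" if "i \<in> I" for i using that by blast
  have "\<exists>k. aff_vec a c $ k \<noteq> 0"
  proof (rule ccontr)
    assume "\<not> (\<exists>k. aff_vec a c $ k \<noteq> 0)"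
    then have "fst c \<bullet> a i + snd c = 0" for i
      by (simp add: aff_vec_def inner_prod_def)
    then have "range a \<subseteq> {x. fst c \<bullet> x = - snd c}"
      by (auto simp: eq_neg_iff_add_eq_0)
    then have "affine hull (range a) \<subseteq> {x. fst c \<bullet> x = - snd c}"
      by (rule hull_minimal) (rule affine_hyperplane)
    then have all: "fst c \<bullet> x = - snd c" for x using aff by auto
    from all[of 0] all[of "fst c"] have "snd c = 0" "fst c = 0" by simp_all
    then show False using c(1) by (simp add: prod_eq_iff)
  qed
  then obtain k where k: "aff_vec a c $ k \<noteq> 0" by blast
  show ?thesis
  proof (cases "aff_vec a c $ k > 0")
    case True
    then show ?thesis using that zero by blast
  next
    case False
    then have "aff_vec a (- c) $ k > 0" using k by (simp add: aff_vec_minus)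
    moreover have "aff_vec a (- c) $ i = 0" if "i \<in> I" for i
      using zero[OF that] by (simp add: aff_vec_minus)
    ultimately show ?thesis using that by blast
  qed
qed

text \<open>
  As long as the points weakly below the affine function are at most \<open>d + 1\<close> in number, the dependency
  \<open>u\<close> among them leaves room to rotate the function about them until it meets a further point.
\<close>
lemma raise_affine:
  fixes a :: "'n::finite \<Rightarrow> real^'d"
  assumes aff: "affine hull (range a) = UNIV" and u: "config_proj a u = 0" "u \<noteq> 0"
    and eq: "\<And>i. i \<in> vec_supp u \<Longrightarrow> w $ i = aff_vec a c $ i"
  shows "\<exists>c'. (\<forall>i. w $ i \<le> aff_vec a c $ i \<longrightarrow> aff_vec a c' $ i = aff_vec a c $ i) \<and>
    (\<forall>i. aff_vec a c $ i < w $ i \<longrightarrow> aff_vec a c' $ i \<le> w $ i) \<and>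
    CARD('d) + 2 \<le> card {i. w $ i \<le> aff_vec a c' $ i}"
  using eq
proof (induction "card {i. aff_vec a c $ i < w $ i}" arbitrary: c rule: less_induct)
  case less
  let ?I = "{i. w $ i \<le> aff_vec a c $ i}"
  show ?case
  proof (cases "CARD('d) + 2 \<le> card ?I")
    case True
    then show ?thesis by (intro exI[of _ c]) auto
  next
    case False
    have "vec_supp u \<subseteq> ?I" using less.prems by auto
    moreover have "card ?I \<le> CARD('d) + 1" using False by linarith
    ultimately obtain h k where h: "\<And>i. i \<in> ?I \<Longrightarrow> aff_vec a h $ i = 0" "aff_vec a h $ k > 0"
      using exists_affine_vanishing[OF aff u, of ?I] by blast
    let ?T = "(\<lambda>i. (w $ i - aff_vec a c $ i) / aff_vec a h $ i) ` {i. aff_vec a h $ i > 0}"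
    \<comment> \<open>The first moment at which adding multiples of \<open>h\<close> makes the graph
      meet a lifted point from below; only points where \<open>h\<close> is positive can be
      met.\<close>
    define t where "t = Min ?T"
    have T: "finite ?T" "?T \<noteq> {}" using h(2) by auto
    obtain j where j: "aff_vec a h $ j > 0" "t = (w $ j - aff_vec a c $ j) / aff_vec a h $ j"
      using Min_in[OF T] unfolding t_def by auto
    have "j \<notin> ?I" using h(1)[of j] j(1) by auto
    then have jw: "aff_vec a c $ j < w $ j" by simp
    then have t: "t > 0" using j by simp
    define c1 where "c1 = c + t *\<^sub>R h"
    have c1: "aff_vec a c1 $ i = aff_vec a c $ i + t * aff_vec a h $ i" for i
      by (simp add: c1_def aff_vec_add aff_vec_scaleR)
    have same: "aff_vec a c1 $ i = aff_vec a c $ i" if "w $ i \<le> aff_vec a c $ i" for i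
      using h(1)[of i] that by (simp add: c1)
    have le: "aff_vec a c1 $ i \<le> w $ i" if i: "aff_vec a c $ i < w $ i" for i
    proof (cases "aff_vec a h $ i > 0")
      case True
      then have "t \<le> (w $ i - aff_vec a c $ i) / aff_vec a h $ i"
        unfolding t_def by (intro Min_le T) auto
      then show ?thesis using True by (simp add: c1 field_simps)
    next
      case False
      then have "t * aff_vec a h $ i \<le> 0" using t by (simp add: mult_le_0_iff)
      then show ?thesis using i by (simp add: c1)
    qed
    have jeq: "aff_vec a c1 $ j = w $ j" using j by (simp add: c1)
    have "{i. aff_vec a c1 $ i < w $ i} \<subseteq> {i. aff_vec a c $ i < w $ i}"
    proof
      fix i assume i: "i \<in> {i. aff_vec a c1 $ i < w $ i}"
      show "i \<in> {i. aff_vec a c $ i < w $ i}"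
      proof (rule ccontr)
        assume "i \<notin> {i. aff_vec a c $ i < w $ i}"
        then show False using same[of i] i by simp
      qed
    qed
    moreover have "j \<in> {i. aff_vec a c $ i < w $ i}" "j \<notin> {i. aff_vec a c1 $ i < w $ i}"
      using jw jeq by auto
    ultimately have "{i. aff_vec a c1 $ i < w $ i} \<subset> {i. aff_vec a c $ i < w $ i}" by blast
    then have "card {i. aff_vec a c1 $ i < w $ i} < card {i. aff_vec a c $ i < w $ i}"
      by (intro psubset_card_mono) auto
    moreover have "w $ i = aff_vec a c1 $ i" if "i \<in> vec_supp u" for i
      using less.prems[OF that] same[of i] by simp
    ultimately obtain c' where c': "\<And>i. w $ i \<le> aff_vec a c1 $ i \<Longrightarrow> aff_vec a c' $ i = aff_vec a c1 $ i"
      "\<And>i. aff_vec a c1 $ i < w $ i \<Longrightarrow> aff_vec a c' $ i \<le> w $ i"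
      "CARD('d) + 2 \<le> card {i. w $ i \<le> aff_vec a c' $ i}"
      using less.hyps[of c1] by blast
    show ?thesis
    proof (intro exI[of _ c'] conjI allI impI c'(3))
      fix i assume "w $ i \<le> aff_vec a c $ i"
      then show "aff_vec a c' $ i = aff_vec a c $ i" using same[of i] c'(1)[of i] by simp
    next
      fix i assume "aff_vec a c $ i < w $ i"
      then have "aff_vec a c1 $ i \<le> w $ i" by (rule le)
      then show "aff_vec a c' $ i \<le> w $ i" using c'(1,2)[of i] by fastforce
    qed
  qed
qed

section \<open>Comparison of the fans\<close>

text \<open>The coefficients sum to zero, so a single nonzero one is impossible. Hence a circuit
  support is large enough to serve as \<open>E\<close> at level \<open>1\<close>.\<close>

lemma two_le_card_circuit:
  assumes "circuit a u"
  shows "2 \<le> card (vec_supp u)"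
proof (rule ccontr)
  assume "\<not> 2 \<le> card (vec_supp u)"
  moreover have "vec_supp u \<noteq> {}" using circuitD(2)[OF assms] by (simp add: vec_supp_empty_iff)
  then have "0 < card (vec_supp u)" by (simp add: card_gt_0_iff)
  ultimately have "card (vec_supp u) = 1" by linarith
  then obtain i where i: "vec_supp u = {i}" by (rule card_1_singletonE)
  have "(\<Sum>j\<in>UNIV. u $ j) = (\<Sum>j\<in>{i}. u $ j)"
    using i by (intro sum.mono_neutral_right) (auto simp: vec_supp_def)
  then show False
    using config_proj_sum_zero[OF circuitD(1)[OF assms]] i by (auto simp: vec_supp_def)
qed

theorem theorem3p11:
  fixes a :: "'n::finite \<Rightarrow> real^'d"
    and k s :: nat
    and P :: "(real^'n) set"
    and F :: "'n set \<Rightarrow> (real^'n) set"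
  assumes "inj a"
    and "affine hull (range a) = UNIV"
    and "k \<in> {1..CARD('d) + 1}"
    and "s = max (CARD('n) - k + 1) (CARD('d) + 2)"
    and "is_hypersecondary_polytope a UNIV k P"
    and "\<And>J. card J = s \<Longrightarrow> is_secondary_polytope a J (F J)"
  shows "normally_equivalent P (\<Sum>J | card J = s. F J)"
proof -
  note inj = assms(1) and aff = assms(2)
  have s: "CARD('n) - k + 1 \<le> s" "CARD('d) + 2 \<le> s" "k < s"
    using assms(3,4) by auto
  have F_hyp: "is_hypersecondary_polytope a J 1 (F J)" if "card J = s" for J
    using assms(6)[OF that] by (simp add: is_secondary_polytope_def)
  have fiber: "polytope Q" "Q \<noteq> {}" if "is_hypersecondary_polytope a J m Q" for J m Q
    using that fiber_polytope_nonempty[OF _ subspace_coord_subspace]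
    by (auto simp: is_hypersecondary_polytope_def is_fiber_polytope_def)
  note P_iff = hypersecondary_min_face_iff[OF assms(5)]
  note F_iff = hypersecondary_min_face_iff[OF F_hyp]
  \<comment> \<open>By convexity the intermediate weight \<open>z\<close> has the same minimal face
    as \<open>v\<close>, so pairs supported for \<open>z\<close> pass to \<open>v\<close>.\<close>
  have segment: "min_face Q ((1 - t) *\<^sub>R w + t *\<^sub>R v) = min_face Q v"
    if Q: "is_hypersecondary_polytope a J m Q" and eq: "min_face Q w = min_face Q v"
      and t: "0 \<le> t" "t \<le> 1" for J m Q t w v
  proof -
    have "min_face Q w \<noteq> {}"
      using fiber[OF Q] by (simp add: min_face_nonempty polytope_imp_compact)
    from min_face_segment[OF eq this t] eq show ?thesis by simp
  qed
  have P_imp_F: "supported a J X E v"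
    if eq: "min_face P w = min_face P v" and J: "card J = s"
      and lev: "level J 1 X E" and w: "supported a J X E w" for J X E w v
  proof (rule ccontr)
    assume nv: "\<not> supported a J X E v"
    obtain t u c where t: "0 \<le> t" "t \<le> 1" and u: "circuit a u" "vec_supp u \<subseteq> J" "u \<bullet> v < 0"
      and on: "\<And>i. i \<in> vec_supp u \<Longrightarrow> ((1 - t) *\<^sub>R w + t *\<^sub>R v) $ i = aff_vec a c $ i"
      and below: "card {i \<in> J. ((1 - t) *\<^sub>R w + t *\<^sub>R v) $ i < aff_vec a c $ i} < 1"
      using level_wall[OF lev w nv] by blast
    define z where "z = (1 - t) *\<^sub>R w + t *\<^sub>R v"
    note on = on[folded z_def] and below = below[folded z_def]
    obtain c' where c': "\<And>i. z $ i \<le> aff_vec a c $ i \<Longrightarrow> aff_vec a c' $ i = aff_vec a c $ i"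
      "\<And>i. aff_vec a c $ i < z $ i \<Longrightarrow> aff_vec a c' $ i \<le> z $ i"
      "CARD('d) + 2 \<le> card {i. z $ i \<le> aff_vec a c' $ i}"
      using raise_affine[OF aff circuitD[OF u(1)] on] by blast
    \<comment> \<open>At level \<open>1\<close> no point of \<open>J\<close> lies strictly below,
      and raising stops at the lifted points. So \<open>?X\<close> avoids \<open>J\<close> and has
      at most \<open>n - s < k\<close> elements, while \<open>?X\<close> and \<open>?E\<close>
      together have at least \<open>d + 2 > k\<close>.\<close>
    let ?X = "{i. z $ i < aff_vec a c' $ i}" and ?E = "{i. z $ i = aff_vec a c' $ i}"
    have "{i \<in> J. z $ i < aff_vec a c $ i} = {}" using below by (simp add: less_eq_Suc_le)
    then have XJ: "?X \<inter> J = {}"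
      using c'(1,2) by (auto simp: not_less) (metis linorder_not_less order_le_less)
    have "card ?X + card J = card (?X \<union> J)" using XJ by (simp add: card_Un_disjoint)
    also have "\<dots> \<le> CARD('n)" by (rule card_mono) auto
    finally have "card ?X < k" using s J assms(3) by auto
    moreover have "card ?X + card ?E = card (?X \<union> ?E)" by (intro card_Un_disjoint[symmetric]) auto
    moreover have "?X \<union> ?E = {i. z $ i \<le> aff_vec a c' $ i}" by auto
    ultimately have "level UNIV k ?X ?E" using c'(3) assms(3) by (auto simp: level_def)
    moreover have "supported a UNIV ?X ?E z"
      unfolding supported_def by (intro exI[of _ c']) auto
    moreover have "min_face P z = min_face P v"
      unfolding z_def by (rule segment[OF assms(5) eq t])
    ultimately have "supported a UNIV ?X ?E v" using P_iff by blast
    then obtain d where d: "\<And>i. i \<in> ?E \<Longrightarrow> v $ i = aff_vec a d $ i"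
      unfolding supported_def by blast
    \<comment> \<open>Raising does not change the affine function on the support of
      \<open>u\<close>, so \<open>v\<close> is affine there and is annihilated by the
      dependency.\<close>
    have "i \<in> ?E" if "i \<in> vec_supp u" for i using on[OF that] c'(1)[of i] by simp
    then have "u \<bullet> v = 0" using d by (intro vec_supp_inner_zero[OF circuitD(1)[OF u(1)]]) blast
    with u(3) show False by simp
  qed
  have F_imp_P: "supported a UNIV X E v"
    if eq: "\<And>J. card J = s \<Longrightarrow> min_face (F J) w = min_face (F J) v"
      and lev: "level UNIV k X E" and w: "supported a UNIV X E w" for X E w v
  proof (rule ccontr)
    assume nv: "\<not> supported a UNIV X E v"
    obtain t u c where t: "0 \<le> t" "t \<le> 1" and u: "circuit a u" "vec_supp u \<subseteq> UNIV" "u \<bullet> v < 0"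
      and on: "\<And>i. i \<in> vec_supp u \<Longrightarrow> ((1 - t) *\<^sub>R w + t *\<^sub>R v) $ i = aff_vec a c $ i"
      and below: "card {i \<in> UNIV. ((1 - t) *\<^sub>R w + t *\<^sub>R v) $ i < aff_vec a c $ i} < k"
      using level_wall[OF lev w nv] by blast
    define z where "z = (1 - t) *\<^sub>R w + t *\<^sub>R v"
    note on = on[folded z_def] and below = below[folded z_def]
    \<comment> \<open>Negation reflects the picture: raising \<open>- c\<close> below
      \<open>- z\<close> lowers \<open>c\<close> until at least \<open>d + 2\<close> points lie
      weakly above it.\<close>
    have "(- z) $ i = aff_vec a (- c) $ i" if "i \<in> vec_supp u" for i
      using on[OF that] by (simp add: aff_vec_minus)
    from raise_affine[OF aff circuitD[OF u(1)] this]
    obtain b where b: "\<And>i. (- z) $ i \<le> aff_vec a (- c) $ i \<Longrightarrow> aff_vec a b $ i = aff_vec a (- c) $ i"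
      "CARD('d) + 2 \<le> card {i. (- z) $ i \<le> aff_vec a b $ i}"
      by blast
    define c' where "c' = - b"
    have bc: "aff_vec a b = - aff_vec a c'" by (simp add: c'_def aff_vec_minus)
    have c': "\<And>i. aff_vec a c $ i \<le> z $ i \<Longrightarrow> aff_vec a c' $ i = aff_vec a c $ i"
      "CARD('d) + 2 \<le> card {i. aff_vec a c' $ i \<le> z $ i}"
      using b by (simp_all add: bc aff_vec_minus)
    let ?U = "{i. aff_vec a c' $ i \<le> z $ i}"
    have "{i. aff_vec a c $ i \<le> z $ i} \<subseteq> ?U" using c'(1) by auto
    then have "card {i. aff_vec a c $ i \<le> z $ i} \<le> card ?U" by (intro card_mono) auto
    moreover have "{i. aff_vec a c $ i \<le> z $ i} = UNIV - {i \<in> UNIV. z $ i < aff_vec a c $ i}" by auto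
    then have "card {i. aff_vec a c $ i \<le> z $ i} = CARD('n) - card {i \<in> UNIV. z $ i < aff_vec a c $ i}"
      by (simp add: card_Diff_subset)
    moreover have "card {i \<in> UNIV. z $ i < aff_vec a c $ i} \<le> CARD('n)" by (rule card_mono) auto
    \<comment> \<open>Fewer than \<open>k\<close> points strictly below leave at least
      \<open>n - k + 1\<close> weakly above, and lowering secures \<open>d + 2\<close>: the two
      terms of the maximum \<open>s\<close>.\<close>
    ultimately have "s \<le> card ?U" using below c'(2) assms(4) by auto
    moreover have suppE: "z $ i = aff_vec a c' $ i" if "i \<in> vec_supp u" for i
      using on[OF that] c'(1)[of i] by simp
    then have "vec_supp u \<subseteq> ?U" by auto
    moreover have "card (vec_supp u) \<le> s" using card_circuit_le[OF inj u(1)] s by linarith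
    \<comment> \<open>A circuit has at most \<open>d + 2 \<le> s\<close> points, so its support
      extends to such a \<open>J\<close>. All of \<open>J\<close> lies weakly above, which permits
      \<open>{}\<close> for \<open>X\<close>.\<close>
    ultimately obtain J where J: "vec_supp u \<subseteq> J" "J \<subseteq> ?U" "card J = s"
      using exists_subset_between[of "vec_supp u" s ?U] by auto
    have "level J 1 {} (vec_supp u)"
      using J(1) two_le_card_circuit[OF u(1)] by (auto simp: level_def)
    moreover have "supported a J {} (vec_supp u) z"
      unfolding supported_def using suppE J(2) by (intro exI[of _ c']) auto
    moreover have "min_face (F J) z = min_face (F J) v"
      unfolding z_def by (rule segment[OF F_hyp[OF J(3)] eq[OF J(3)] t])
    ultimately have "supported a J {} (vec_supp u) v" using F_iff[OF J(3)] by blast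
    then obtain d where "\<And>i. i \<in> vec_supp u \<Longrightarrow> v $ i = aff_vec a d $ i"
      unfolding supported_def by blast
    then have "u \<bullet> v = 0" by (intro vec_supp_inner_zero[OF circuitD(1)[OF u(1)]])
    with u(3) show False by simp
  qed
  have sum: "polytope (\<Sum>J | card J = s. F J) \<and> (\<Sum>J | card J = s. F J) \<noteq> {} \<and>
    (\<forall>v w. min_face (\<Sum>J | card J = s. F J) v = min_face (\<Sum>J | card J = s. F J) w \<longleftrightarrow>
       (\<forall>J\<in>{J. card J = s}. min_face (F J) v = min_face (F J) w))"
    using fiber[OF F_hyp] by (intro min_face_sum_iff) auto
  have iff: "min_face P w = min_face P v \<longleftrightarrow> (\<forall>J\<in>{J. card J = s}. min_face (F J) w = min_face (F J) v)"
    for w v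
  proof
    assume eq: "min_face P w = min_face P v"
    have "min_face (F J) w = min_face (F J) v" if J: "card J = s" for J
      unfolding F_iff[OF J] using P_imp_F[OF eq J] P_imp_F[OF eq[symmetric] J] by blast
    then show "\<forall>J\<in>{J. card J = s}. min_face (F J) w = min_face (F J) v" by simp
  next
    assume "\<forall>J\<in>{J. card J = s}. min_face (F J) w = min_face (F J) v"
    then have eq: "card J = s \<Longrightarrow> min_face (F J) w = min_face (F J) v" for J by simp
    show "min_face P w = min_face P v"
      unfolding P_iff using F_imp_P[OF eq] F_imp_P[OF eq[symmetric]] by blast
  qed
  show ?thesis
    by (rule normally_equivalentI) (use fiber[OF assms(5)] sum iff in auto)
qed

end
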